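(* Let $\mathcal{M}\subset B(\mathcal{H})$ be an operator space and let $\phi:\mathcal{M}\to B(\mathcal{H}_\phi)$ be an element of $\mathcal{P}_r(\mathcal{M},\mathcal{H}_\phi)$, where $r\geq 1$. Then there is a Hilbert space $\mathcal{K}_\phi$ containing $\mathcal{H}_\phi$, a $*$-homomorphism $\sigma:C^*(\mathcal{M})\to B(\mathcal{K}_\phi)$ and an invertible operator $X\in B(\mathcal{K}_\phi)$ with $\|X\|=\|X^{-1}\|\leq r^{1/2}$ such that \[ \phi(a)=P_{\mathcal{H}_\phi}X\sigma(a)X^{-1}|_{\mathcal{H}_\phi},\quad a\in\mathcal{M}. \] In particular, there is a contractive completely positive linear map $\psi:C^*(\mathcal{M})\to B(\mathcal{H}_\phi)$ with the property that \[ \|\phi-\psi|_{\mathcal{M}}\|_{cb}\leq r-1. \]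
   Context: An operator space is a linear subspace $\mathcal{M}\subset B(\mathcal{H})$ for some Hilbert space $\mathcal{H}$; an operator algebra is a subalgebra of some $B(\mathcal{H})$. Neither is assumed to contain the identity. $C^*(\mathcal{M})$ denotes the $C^*$-algebra generated by $\mathcal{M}$ inside $B(\mathcal{H})$. Homomorphisms and $*$-homomorphisms are not assumed to be unital. A completely bounded homomorphism $\theta:\mathcal{A}\to B(\mathcal{K})$ on an operator algebra $\mathcal{A}$ has Paulsen's similarity property with constant $c\geq 1$ if there is an invertible $X\in B(\mathcal{K})$ with $\|X\|=\|X^{-1}\|\leq c$ such that the map $a\mapsto X\theta(a)X^{-1}$, $a\in\mathcal{A}$, is completely contractive. For an operator space $\mathcal{M}$, $r\geq 1$ and a Hilbert space $\mathcal{H}'$, $\mathcal{P}_r(\mathcal{M},\mathcal{H}')$ is the set of linear maps $\phi:\mathcal{M}\to B(\mathcal{H}')$ for which there is a Hilbert space $\mathcal{K}_\phi\supset\mathcal{H}'$ and a completely bounded homomorphism $\theta:C^*(\mathcal{M})\to B(\mathcal{K}_\phi)$ having Paulsen's similarity property with constant $r^{1/2}$ such that $\phi(a)=P_{\mathcal{H}'}\theta(a)|_{\mathcal{H}'}$ for all $a\in\mathcal{M}$. *)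

theory Defs
  imports "HOL-Analysis.Analysis"
begin

section \<open>Complex Hilbert spaces\<close>

class scaleC =
  fixes scaleC :: "complex \<Rightarrow> 'a \<Rightarrow> 'a"  (infixr "*\<^sub>C" 75)

class complex_vector = real_vector + scaleC +
  assumes scaleC_add_right: "a *\<^sub>C (x + y) = a *\<^sub>C x + a *\<^sub>C y"
    and scaleC_add_left: "(a + b) *\<^sub>C x = a *\<^sub>C x + b *\<^sub>C x"
    and scaleC_scaleC: "a *\<^sub>C b *\<^sub>C x = (a * b) *\<^sub>C x"
    and scaleC_one: "1 *\<^sub>C x = x"
    and scaleR_scaleC: "r *\<^sub>R x = complex_of_real r *\<^sub>C x"

interpretation complex_vector: vector_space "scaleC :: complex \<Rightarrow> 'a \<Rightarrow> 'a::complex_vector"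
  by unfold_locales (auto simp: scaleC_add_right scaleC_add_left scaleC_scaleC scaleC_one)

text \<open>The real inner product of the library is the real part of the complex one, which is linear
  in its first argument. In particular \<open>norm x = sqrt (Re (cinner x x))\<close>, and the definiteness
  axioms are inherited from \<^class>\<open>real_inner\<close>.\<close>

class complex_inner = complex_vector + real_inner +
  fixes cinner :: "'a \<Rightarrow> 'a \<Rightarrow> complex"
  assumes cinner_commute: "cinner x y = cnj (cinner y x)"
    and cinner_add_left: "cinner (x + y) z = cinner x z + cinner y z"
    and cinner_scaleC_left: "cinner (c *\<^sub>C x) y = c * cinner x y"
    and inner_eq_Re_cinner: "inner x y = Re (cinner x y)"

class chilbert_space = complex_inner + complete_space

lemma norm_scaleC: "norm (c *\<^sub>C x) = cmod c * norm (x::'a::complex_inner)"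
proof -
  have *: "cinner y (c *\<^sub>C x) = cnj c * cinner y x" for y :: 'a
    by (metis cinner_commute cinner_scaleC_left complex_cnj_mult)
  have "inner (c *\<^sub>C x) (c *\<^sub>C x) = Re ((c * cnj c) * cinner x x)"
    by (simp only: inner_eq_Re_cinner cinner_scaleC_left * mult_ac)
  also have "\<dots> = (cmod c)\<^sup>2 * inner x x"
    by (simp only: complex_norm_square[symmetric] inner_eq_Re_cinner Re_complex_of_real times_complex.sel
        Im_complex_of_real mult_zero_left diff_zero)
  finally show ?thesis
    by (simp add: norm_eq_sqrt_inner real_sqrt_mult)
qed

instantiation complex :: chilbert_space
begin

definition scaleC_complex :: "complex \<Rightarrow> complex \<Rightarrow> complex"
  where "scaleC_complex c x = c * x"

definition cinner_complex :: "complex \<Rightarrow> complex \<Rightarrow> complex"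
  where "cinner_complex x y = x * cnj y"

instance
  by standard (auto simp: scaleC_complex_def cinner_complex_def inner_complex_def algebra_simps
      scaleR_conv_of_real)

end

instantiation blinfun :: (real_normed_vector, complex_inner) complex_vector
begin

lift_definition scaleC_blinfun :: "complex \<Rightarrow> 'a \<Rightarrow>\<^sub>L 'b \<Rightarrow> 'a \<Rightarrow>\<^sub>L 'b"
  is "\<lambda>c f x. c *\<^sub>C f x"
proof -
  fix c :: complex and f :: "'a \<Rightarrow> 'b"
  assume "bounded_linear f"
  then interpret f: bounded_linear f .
  obtain K where K: "\<And>x. norm (f x) \<le> norm x * K"
    using f.bounded by blast
  show "bounded_linear (\<lambda>x. c *\<^sub>C f x)"
  proof (rule bounded_linear_intro[where K = "cmod c * K"])
    show "norm (c *\<^sub>C f x) \<le> norm x * (cmod c * K)" for x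
      using mult_left_mono[OF K[of x], of "cmod c"] by (simp add: norm_scaleC mult_ac)
  qed (auto simp: f.add f.scaleR scaleC_add_right scaleR_scaleC scaleC_scaleC mult.commute)
qed

instance
  by standard (transfer; auto simp: scaleC_add_right scaleC_add_left scaleC_scaleC scaleC_one scaleR_scaleC)+

end


section \<open>Bounded operators\<close>

text \<open>The type \<^typ>\<open>'a \<Rightarrow>\<^sub>L 'b\<close> consists of the bounded \<^emph>\<open>real\<close>-linear maps. \<open>bounded_ops\<close> is the
  set of complex-linear ones; at type \<^typ>\<open>'a \<Rightarrow>\<^sub>L 'a\<close> it is $B(H)$ for the Hilbert space $H$ given
  by \<^typ>\<open>'a\<close>.\<close>

definition bounded_ops :: "('a::chilbert_space \<Rightarrow>\<^sub>L 'b::chilbert_space) set"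
  where "bounded_ops = {T. \<forall>c x. blinfun_apply T (c *\<^sub>C x) = c *\<^sub>C blinfun_apply T x}"

definition adj :: "('a::chilbert_space \<Rightarrow>\<^sub>L 'b::chilbert_space) \<Rightarrow> ('b \<Rightarrow>\<^sub>L 'a)"
  where "adj T = (THE S. \<forall>x y. cinner (blinfun_apply T x) y = cinner x (blinfun_apply S y))"

definition mutually_inverse :: "('a::chilbert_space \<Rightarrow>\<^sub>L 'a) \<Rightarrow> ('a \<Rightarrow>\<^sub>L 'a) \<Rightarrow> bool"
  where "mutually_inverse X Y \<longleftrightarrow>
    X \<in> bounded_ops \<and> Y \<in> bounded_ops \<and> X o\<^sub>L Y = id_blinfun \<and> Y o\<^sub>L X = id_blinfun"

text \<open>An inclusion $H \subset K$ of Hilbert spaces is given by a linear isometry $V : H \to K$.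
  Identifying $H$ with the range of $V$, the operator $P_H T|_H$ is $V^* T V$.\<close>

definition hilbert_inclusion :: "('a::chilbert_space \<Rightarrow>\<^sub>L 'b::chilbert_space) \<Rightarrow> bool"
  where "hilbert_inclusion V \<longleftrightarrow> V \<in> bounded_ops \<and> (\<forall>x. norm (V x) = norm x)"

definition compression ::
    "('a::chilbert_space \<Rightarrow>\<^sub>L 'b::chilbert_space) \<Rightarrow> ('b \<Rightarrow>\<^sub>L 'b) \<Rightarrow> ('a \<Rightarrow>\<^sub>L 'a)"
  where "compression V T = adj V o\<^sub>L T o\<^sub>L V"


section \<open>Operator spaces and C*-algebras of operators\<close>

definition operator_space :: "('a::chilbert_space \<Rightarrow>\<^sub>L 'a) set \<Rightarrow> bool"
  where "operator_space M \<longleftrightarrow> M \<subseteq> bounded_ops \<and> complex_vector.subspace M"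

definition cstar_subalgebra :: "('a::chilbert_space \<Rightarrow>\<^sub>L 'a) set \<Rightarrow> bool"
  where "cstar_subalgebra A \<longleftrightarrow>
    A \<subseteq> bounded_ops \<and> complex_vector.subspace A \<and>
    (\<forall>a\<in>A. \<forall>b\<in>A. a o\<^sub>L b \<in> A) \<and> (\<forall>a\<in>A. adj a \<in> A) \<and> closed A"

definition cstar_generated :: "('a::chilbert_space \<Rightarrow>\<^sub>L 'a) set \<Rightarrow> ('a \<Rightarrow>\<^sub>L 'a) set"
  where "cstar_generated M = cstar_subalgebra hull M"


section \<open>Linear maps, homomorphisms and *-homomorphisms\<close>

text \<open>Maps out of a space $S$ of operators are total functions of which only the values on $S$
  matter.\<close>

definition clinear_into_ops ::
    "('a::chilbert_space \<Rightarrow>\<^sub>L 'a) set \<Rightarrow> (('a \<Rightarrow>\<^sub>L 'a) \<Rightarrow> ('b::chilbert_space \<Rightarrow>\<^sub>L 'b)) \<Rightarrow> bool"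
  where "clinear_into_ops S f \<longleftrightarrow>
    f ` S \<subseteq> bounded_ops \<and>
    (\<forall>a\<in>S. \<forall>b\<in>S. f (a + b) = f a + f b) \<and> (\<forall>c. \<forall>a\<in>S. f (c *\<^sub>C a) = c *\<^sub>C f a)"

definition op_hom ::
    "('a::chilbert_space \<Rightarrow>\<^sub>L 'a) set \<Rightarrow> (('a \<Rightarrow>\<^sub>L 'a) \<Rightarrow> ('b::chilbert_space \<Rightarrow>\<^sub>L 'b)) \<Rightarrow> bool"
  where "op_hom A f \<longleftrightarrow> clinear_into_ops A f \<and> (\<forall>a\<in>A. \<forall>b\<in>A. f (a o\<^sub>L b) = f a o\<^sub>L f b)"

definition star_hom ::
    "('a::chilbert_space \<Rightarrow>\<^sub>L 'a) set \<Rightarrow> (('a \<Rightarrow>\<^sub>L 'a) \<Rightarrow> ('b::chilbert_space \<Rightarrow>\<^sub>L 'b)) \<Rightarrow> bool"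
  where "star_hom A f \<longleftrightarrow> op_hom A f \<and> (\<forall>a\<in>A. f (adj a) = adj (f a))"


section \<open>Matrices of operators, complete boundedness and complete positivity\<close>

text \<open>An $n \times n$ matrix over $B(H)$ is given by the entries \<open>A i j\<close> with \<open>i, j < n\<close>, and
  vectors in $H^n$ by the values \<open>x i\<close> with \<open>i < n\<close>; all other values are ignored. \<open>mat_norm n A\<close> is
  the operator norm of \<open>A\<close> acting on the Hilbert space $H^n$.\<close>

definition mat_norm :: "nat \<Rightarrow> (nat \<Rightarrow> nat \<Rightarrow> ('a::chilbert_space \<Rightarrow>\<^sub>L 'a)) \<Rightarrow> real"
  where "mat_norm n A =
    (SUP x\<in>{x. L2_set (\<lambda>i. norm (x i)) {..<n} \<le> 1}. L2_set (\<lambda>i. norm (\<Sum>j<n. A i j (x j))) {..<n})"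

definition mat_positive :: "nat \<Rightarrow> (nat \<Rightarrow> nat \<Rightarrow> ('a::chilbert_space \<Rightarrow>\<^sub>L 'a)) \<Rightarrow> bool"
  where "mat_positive n A \<longleftrightarrow>
    (\<forall>x. (\<Sum>i<n. cinner (\<Sum>j<n. A i j (x j)) (x i)) \<in> \<real>\<^sub>\<ge>\<^sub>0)"

text \<open>The norm is extended-real valued, so that it is \<open>\<infinity>\<close> for maps which are not completely
  bounded.\<close>

definition cb_norm ::
    "('a::chilbert_space \<Rightarrow>\<^sub>L 'a) set \<Rightarrow> (('a \<Rightarrow>\<^sub>L 'a) \<Rightarrow> ('b::chilbert_space \<Rightarrow>\<^sub>L 'b)) \<Rightarrow> ereal"
  where "cb_norm S f =
    (SUP (n, A) \<in> {(n, A). (\<forall>i<n. \<forall>j<n. A i j \<in> S) \<and> mat_norm n A \<le> 1}.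
      ereal (mat_norm n (\<lambda>i j. f (A i j))))"

definition completely_bounded ::
    "('a::chilbert_space \<Rightarrow>\<^sub>L 'a) set \<Rightarrow> (('a \<Rightarrow>\<^sub>L 'a) \<Rightarrow> ('b::chilbert_space \<Rightarrow>\<^sub>L 'b)) \<Rightarrow> bool"
  where "completely_bounded S f \<longleftrightarrow> cb_norm S f < \<infinity>"

definition completely_contractive ::
    "('a::chilbert_space \<Rightarrow>\<^sub>L 'a) set \<Rightarrow> (('a \<Rightarrow>\<^sub>L 'a) \<Rightarrow> ('b::chilbert_space \<Rightarrow>\<^sub>L 'b)) \<Rightarrow> bool"
  where "completely_contractive S f \<longleftrightarrow> cb_norm S f \<le> 1"

definition contractive ::
    "('a::chilbert_space \<Rightarrow>\<^sub>L 'a) set \<Rightarrow> (('a \<Rightarrow>\<^sub>L 'a) \<Rightarrow> ('b::chilbert_space \<Rightarrow>\<^sub>L 'b)) \<Rightarrow> bool"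
  where "contractive S f \<longleftrightarrow> (\<forall>a\<in>S. norm (f a) \<le> norm a)"

definition completely_positive ::
    "('a::chilbert_space \<Rightarrow>\<^sub>L 'a) set \<Rightarrow> (('a \<Rightarrow>\<^sub>L 'a) \<Rightarrow> ('b::chilbert_space \<Rightarrow>\<^sub>L 'b)) \<Rightarrow> bool"
  where "completely_positive S f \<longleftrightarrow>
    (\<forall>n A. (\<forall>i<n. \<forall>j<n. A i j \<in> S) \<and> mat_positive n A \<longrightarrow> mat_positive n (\<lambda>i j. f (A i j)))"


section \<open>Paulsen's similarity property and the class \<open>P_r\<close>\<close>

definition paulsen_similarity ::
    "('a::chilbert_space \<Rightarrow>\<^sub>L 'a) set \<Rightarrow> (('a \<Rightarrow>\<^sub>L 'a) \<Rightarrow> ('b::chilbert_space \<Rightarrow>\<^sub>L 'b)) \<Rightarrow> real \<Rightarrow> bool"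
  where "paulsen_similarity A \<theta> c \<longleftrightarrow>
    (\<exists>X Y. mutually_inverse X Y \<and> norm X = norm Y \<and> norm Y \<le> c \<and>
      completely_contractive A (\<lambda>a. X o\<^sub>L \<theta> a o\<^sub>L Y))"

text \<open>HOL has no quantification over types, so the Hilbert space $K_\phi$ of the dilation is a type
  parameter \<^typ>\<open>'k\<close>: \<open>P_class TYPE('k) r M\<close> is the set of those maps $\phi$ for which the required
  $K_\phi \supset H'$ and $\theta$ exist with $K_\phi$ of type \<^typ>\<open>'k\<close>. Membership of $\phi$ in
  $\mathcal{P}_r(M, H')$ means that this holds for some type \<^typ>\<open>'k\<close>; as a hypothesis of a
  theorem, this is expressed by leaving \<^typ>\<open>'k\<close> an arbitrary type variable.\<close>

definition P_class :: "'k::chilbert_space itself \<Rightarrow> real \<Rightarrow> ('a::chilbert_space \<Rightarrow>\<^sub>L 'a) set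
    \<Rightarrow> (('a \<Rightarrow>\<^sub>L 'a) \<Rightarrow> ('b::chilbert_space \<Rightarrow>\<^sub>L 'b)) set"
  where "P_class K r M = {\<phi>. clinear_into_ops M \<phi> \<and>
    (\<exists>(V :: 'b \<Rightarrow>\<^sub>L 'k) (\<theta> :: ('a \<Rightarrow>\<^sub>L 'a) \<Rightarrow> ('k \<Rightarrow>\<^sub>L 'k)).
      hilbert_inclusion V \<and>
      op_hom (cstar_generated M) \<theta> \<and>
      completely_bounded (cstar_generated M) \<theta> \<and>
      paulsen_similarity (cstar_generated M) \<theta> (sqrt r) \<and>
      (\<forall>a\<in>M. \<phi> a = compression V (\<theta> a)))}"

end

theory Submission
  imports Defs
begin

text \<open>Conjugating the given homomorphism $\theta$ by the similarity $X$ gives a completely contractive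
  homomorphism $\sigma = X \theta X^{-1}$, and a contractive homomorphism of a C*-algebra is
  automatically a *-homomorphism: for a self-adjoint contraction $a$ the polynomials
  $1 - (1 - a^2)^n$ serve as an approximate unit, and $\|(1 + ita) y\|^2 \le (1 + t^2) \|y\|^2$ for all
  real $t$ forces $\sigma(a)$ to be self-adjoint.

  For the second part no polar decomposition of $X$ is needed. Put $W = (X + X^{-*}) V / 2$ and
  $D = (X - X^{-*}) V / 2$, so that $\phi = (W - D)^* \sigma (W + D)$ on $M$. Since
  $X^* X + (X^* X)^{-1} \le r + 1/r$, the norms of $W$ and $D$ are at most
  $\kappa = (r^{1/2} + r^{-1/2}) / 2$ and $\delta = (r^{1/2} - r^{-1/2}) / 2$. Hence
  $\psi = W^* \sigma W / \kappa^2$ is contractive and completely positive, and $\phi - \psi$ has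
  completely bounded norm at most $(\kappa^2 - 1) + 2 \kappa \delta + \delta^2 = r - 1$.\<close>

section \<open>Riesz representation and adjoints\<close>

text \<open>Neither the algebra nor the homomorphism has a unit, and this shapes the argument.
  Symmetry must then be spread from that range to all vectors. For complete positivity of \<sigma>,
  no factorization B = C^* C is used but a test by polynomials without constant term: a self-adjoint
  contraction B is positive exactly when all B(1 - B)^k are contractions. Such polynomials stay in
  the algebra, and a completely contractive homomorphism preserves the bounds. W and D have their
  origin in the polar decomposition X = U|X|: since X^{-*} = U|X|^{-1}, they are U cosh(log|X|) V
  and U sinh(log|X|) V. The spectrum of log|X| lies within (log r)/2 of zero, so \<kappa> and
  \<delta> are cosh and sinh of (log r)/2. The proof reaches these bounds through a quadratic
  inequality for X X^* instead.\<close>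

lemma riesz_representation_real:
  fixes f :: "'a::{real_inner,complete_space} \<Rightarrow> real"
  assumes "bounded_linear f"
  obtains z where "\<And>x. f x = inner x z"
proof -
  interpret f: bounded_linear f by fact
  \<comment> \<open>For a representing vector \<open>z\<close> one would have \<open>J x\<close> =
    |x - z|^2 - |z|^2, so \<open>z\<close> is sought as a minimizer of \<open>J\<close>.\<close>
  define J where "J x = (norm x)\<^sup>2 - 2 * f x" for x
  obtain K where K: "\<And>x. norm (f x) \<le> norm x * K"
    using f.bounded by blast
  have Jlow: "J x \<ge> - K\<^sup>2" for x
  proof -
    have "f x \<le> norm x * K" using K[of x] by simp
    moreover have "(norm x - K)\<^sup>2 \<ge> 0" by simp
    ultimately show ?thesis by (simp add: J_def power2_diff)
  qed
  have bdd: "bdd_below (range J)"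
    using Jlow by (auto intro!: bdd_belowI)
  define m where "m = (INF x. J x)"
  have m_le: "m \<le> J x" for x
    unfolding m_def by (rule cINF_lower[OF bdd]) simp
  have "\<exists>x. J x < m + 1 / real (Suc n)" for n
  proof -
    have "m < m + 1 / real (Suc n)" by simp
    then show ?thesis unfolding m_def by (subst (asm) cINF_less_iff) (use bdd in auto)
  qed
  then have "\<forall>n. \<exists>x. J x < m + 1 / real (Suc n)" by blast
  then obtain X where X: "\<And>n. J (X n) < m + 1 / real (Suc n)" by (rule choice[THEN exE]) blast
  \<comment> \<open>The parallelogram law; the linear part of \<open>J\<close> cancels, so two
    points close to the infimum are close to each other.\<close>
  have par: "(norm (x - y))\<^sup>2 = 2 * J x + 2 * J y - 4 * J ((1/2) *\<^sub>R (x + y))" for x y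
    by (simp add: J_def power2_norm_eq_inner f.scaleR f.add algebra_simps inner_commute)
  have par_le: "(norm (x - y))\<^sup>2 \<le> 2 * (J x - m) + 2 * (J y - m)" for x y
    using par[of x y] m_le[of "(1/2) *\<^sub>R (x + y)"] by simp
  have "Cauchy X"
  proof (rule CauchyI)
    fix e :: real assume e: "0 < e"
    obtain N where N: "4 / e\<^sup>2 < real N" using reals_Archimedean2 by blast
    show "\<exists>M. \<forall>i\<ge>M. \<forall>n\<ge>M. norm (X i - X n) < e"
    proof (intro exI allI impI)
      fix i n assume ij: "N \<le> i" "N \<le> n"
      have N0: "real N > 0" using N e by (smt (verit) divide_pos_pos zero_less_power)
      have gap: "J (X k) - m \<le> 1 / real N" if "N \<le> k" for k
      proof -
        have "1 / real (Suc k) \<le> 1 / real N" using that N0 by (intro divide_left_mono) auto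
        then show ?thesis using X[of k] by simp
      qed
      have "(norm (X i - X n))\<^sup>2 \<le> 2 * (1 / real N) + 2 * (1 / real N)"
        by (rule order_trans[OF par_le]) (intro add_mono mult_left_mono gap ij; simp)
      also have "\<dots> = 4 / real N" by simp
      also have "\<dots> < e\<^sup>2" using N N0 e by (simp add: field_simps)
      finally show "norm (X i - X n) < e" using e by (simp add: power2_less_imp_less)
    qed
  qed
  then obtain z where z: "X \<longlonglongrightarrow> z" using Cauchy_convergent convergent_def by blast
  have "(\<lambda>n. J (X n)) \<longlonglongrightarrow> J z"
    unfolding J_def
    by (rule tendsto_diff[OF tendsto_power[OF tendsto_norm[OF z]]
          tendsto_mult[OF tendsto_const f.tendsto[OF z]]])
  moreover have "(\<lambda>n. m + 1 / real (Suc n)) \<longlonglongrightarrow> m"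
    using LIMSEQ_inverse_real_of_nat_add[of m] by (simp only: inverse_eq_divide)
  ultimately have "J z \<le> m"
    by (rule LIMSEQ_le) (intro exI[of _ 0] allI impI less_imp_le X)
  then have Jz: "J z \<le> J x" for x using m_le[of x] by simp
  have "f x = inner x z" for x
  proof (cases "x = 0")
    case False
    define q where "q = inner x z - f x"
    define n where "n = (norm x)\<^sup>2"
    have n: "n > 0" using False by (simp add: n_def)
    \<comment> \<open>The quadratic polynomial t |-> J(z + t x) has its minimum at t = -q/n; a
      strict decrease there would contradict the minimality of \<open>z\<close>.\<close>
    have "J (z + (- (q / n)) *\<^sub>R x) = J z - q\<^sup>2 / n"
    proof -
      have "J (z + t *\<^sub>R x) = J z + 2 * t * q + t\<^sup>2 * n" for t
        by (simp add: J_def q_def n_def power2_norm_eq_inner f.scaleR f.add algebra_simps inner_commute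
            power2_eq_square[of t])
      moreover have "2 * (- (q / n)) * q + (- (q / n))\<^sup>2 * n = - (q\<^sup>2 / n)"
        using n by (simp add: power2_eq_square)
      ultimately show ?thesis by (metis add.assoc diff_conv_add_uminus)
    qed
    with Jz[of "z + (- (q / n)) *\<^sub>R x"] have "q\<^sup>2 / n \<le> 0" by simp
    then have "q = 0" using n by (simp add: divide_le_0_iff)
    then show ?thesis by (simp add: q_def)
  qed simp
  then show ?thesis by (rule that)
qed

section \<open>Adjoints through the real inner product\<close>

lemma cinner_scaleC_right: "cinner x (c *\<^sub>C y) = cnj c * cinner x y"
  by (metis cinner_commute cinner_scaleC_left complex_cnj_mult)

lemma inner_scaleC_left: "inner (c *\<^sub>C x) y = inner x (cnj c *\<^sub>C (y::'a::complex_inner))"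
  by (simp add: inner_eq_Re_cinner cinner_scaleC_left cinner_scaleC_right)

lemma cinner_eq_inner: "cinner x y = Complex (inner x y) (inner x (\<i> *\<^sub>C y))"
  by (simp add: complex_eq_iff inner_eq_Re_cinner cinner_scaleC_right)

lemma scaleC_diff_right: "c *\<^sub>C (x - y) = c *\<^sub>C x - c *\<^sub>C (y::'a::complex_vector)"
  by (rule complex_vector.scale_right_diff_distrib)

lemma bounded_opsD: "T \<in> bounded_ops \<Longrightarrow> blinfun_apply T (c *\<^sub>C x) = c *\<^sub>C blinfun_apply T x"
  by (simp add: bounded_ops_def)

text \<open>The imaginary part of \<open>cinner x y\<close> is the real inner product of
  \<open>x\<close> with \<open>\<i> *\<^sub>C y\<close>, and \<open>T\<close> commutes with
  multiplication by i. Adjoints can therefore be handled entirely with \<open>inner\<close>.\<close>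

lemma cinner_adjointI:
  assumes "T \<in> bounded_ops" "\<And>x y. inner (blinfun_apply T x) y = inner x (blinfun_apply S y)"
  shows "cinner (blinfun_apply T x) y = cinner x (blinfun_apply S y)"
proof -
  have "inner (T x) (\<i> *\<^sub>C y) = inner (T (cnj \<i> *\<^sub>C x)) y"
    by (simp only: bounded_opsD[OF assms(1)] inner_scaleC_left complex_cnj_cnj)
  also have "\<dots> = inner x (\<i> *\<^sub>C S y)"
    by (simp only: assms(2) inner_scaleC_left complex_cnj_cnj)
  finally show ?thesis by (simp add: cinner_eq_inner assms(2))
qed

lemma inner_right_ext:
  fixes u v :: "'a::real_inner"
  assumes "\<And>x. inner x u = inner x v"
  shows "u = v"
proof -
  have "inner (u - v) (u - v) = 0" by (simp only: inner_diff_right assms diff_self)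
  then show ?thesis by simp
qed

lemma adjoint_exists:
  fixes T :: "'a::chilbert_space \<Rightarrow>\<^sub>L 'b::chilbert_space"
  obtains S :: "'b \<Rightarrow>\<^sub>L 'a" where "\<And>x y. inner (blinfun_apply T x) y = inner x (blinfun_apply S y)"
proof -
  have "\<exists>z. \<forall>x. inner (T x) y = inner x z" for y
  proof -
    have "bounded_linear (\<lambda>x. inner (T x) y)"
      by (intro bounded_linear_intros)
    then show ?thesis using riesz_representation_real by blast
  qed
  then obtain s where s: "\<And>x y. inner (T x) y = inner x (s y)" by metis
  have "bounded_linear s"
  proof (rule bounded_linear_intro[where K = "norm T"])
    show "s (x + y) = s x + s y" for x y
      by (rule inner_right_ext) (simp add: s[symmetric] inner_add_right)
    show "s (r *\<^sub>R x) = r *\<^sub>R s x" for r x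
      by (rule inner_right_ext) (simp add: s[symmetric])
    show "norm (s x) \<le> norm x * norm T" for x
    proof (cases "s x = 0")
      case False
      have "norm (s x) * norm (s x) = inner (T (s x)) x"
        by (simp add: s power2_norm_eq_inner[symmetric] power2_eq_square)
      also have "\<dots> \<le> norm (T (s x)) * norm x" by (rule norm_cauchy_schwarz)
      also have "\<dots> \<le> norm T * norm (s x) * norm x"
        by (intro mult_right_mono norm_blinfun) auto
      finally show ?thesis using False by (simp add: mult_ac)
    qed simp
  qed
  then show ?thesis using that[of "Blinfun s"] s by (simp add: bounded_linear_Blinfun_apply)
qed

text \<open>Resolves the definite description in \<open>adj\<close> from an identity for the real
  inner product alone, which makes it the working rule for computing adjoints.\<close>

lemma adj_eqI:
  assumes T: "T \<in> bounded_ops"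
    and S: "\<And>x y. inner (blinfun_apply T x) y = inner x (blinfun_apply S y)"
  shows "adj T = S"
  unfolding adj_def
proof (rule the_equality)
  show "\<forall>x y. cinner (T x) y = cinner x (S y)"
    using cinner_adjointI[OF T S] by blast
next
  fix S' assume "\<forall>x y. cinner (T x) y = cinner x (blinfun_apply S' y)"
  then have "inner x (S' y) = inner x (S y)" for x y
    using S[of x y] by (metis inner_eq_Re_cinner)
  then show "S' = S" by (blast intro: blinfun_eqI inner_right_ext)
qed

lemma inner_adj:
  assumes "T \<in> bounded_ops"
  shows "inner (blinfun_apply T x) y = inner x (blinfun_apply (adj T) y)"
proof -
  obtain S where S: "\<And>x y. inner (T x) y = inner x (blinfun_apply S y)"
    using adjoint_exists by blast
  then show ?thesis using adj_eqI[OF assms S] by simp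
qed

lemma inner_adj':
  assumes "T \<in> bounded_ops"
  shows "inner y (blinfun_apply T x) = inner (blinfun_apply (adj T) y) x"
  using inner_adj[OF assms, of x y] by (simp add: inner_commute)

lemma adj_bounded_ops:
  assumes "T \<in> bounded_ops"
  shows "adj T \<in> bounded_ops"
proof -
  have "adj T (c *\<^sub>C x) = c *\<^sub>C adj T x" for c x
  proof (rule inner_right_ext)
    fix y
    have "inner y (adj T (c *\<^sub>C x)) = inner (cnj c *\<^sub>C T y) x"
      by (simp add: inner_adj[OF assms, symmetric] inner_scaleC_left)
    also have "\<dots> = inner y (c *\<^sub>C adj T x)"
      by (simp add: bounded_opsD[OF assms, symmetric] inner_adj[OF assms] inner_scaleC_left
)
    finally show "inner y (adj T (c *\<^sub>C x)) = inner y (c *\<^sub>C adj T x)" .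
  qed
  then show ?thesis by (simp add: bounded_ops_def)
qed

lemma norm_adj_le:
  assumes "T \<in> bounded_ops"
  shows "norm (adj T) \<le> norm T"
proof (rule norm_blinfun_bound)
  fix x
  show "norm (adj T x) \<le> norm T * norm x"
  proof (cases "adj T x = 0")
    case False
    have "norm (adj T x) * norm (adj T x) = inner (T (adj T x)) x"
      by (simp add: inner_adj[OF assms] power2_norm_eq_inner[symmetric] power2_eq_square)
    also have "\<dots> \<le> norm (T (adj T x)) * norm x" by (rule norm_cauchy_schwarz)
    also have "\<dots> \<le> norm T * norm (adj T x) * norm x"
      by (intro mult_right_mono norm_blinfun) auto
    finally show ?thesis using False by (simp add: mult_ac)
  qed simp
qed simp

section \<open>Complex-linear operators and generated C*-algebras\<close>

lemma scaleC_blinfun_apply [simp]: "blinfun_apply (c *\<^sub>C T) x = c *\<^sub>C blinfun_apply T x"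
  by (simp add: scaleC_blinfun.rep_eq)

lemma bounded_ops_add: "S \<in> bounded_ops \<Longrightarrow> T \<in> bounded_ops \<Longrightarrow> S + T \<in> bounded_ops"
  by (simp add: bounded_ops_def blinfun.add_left scaleC_add_right)

lemma bounded_ops_diff: "S \<in> bounded_ops \<Longrightarrow> T \<in> bounded_ops \<Longrightarrow> S - T \<in> bounded_ops"
  by (simp add: bounded_ops_def blinfun.diff_left scaleC_diff_right)

lemma bounded_ops_scaleC: "T \<in> bounded_ops \<Longrightarrow> c *\<^sub>C T \<in> bounded_ops"
  by (simp add: bounded_ops_def scaleC_scaleC mult.commute)

lemma bounded_ops_scaleR: "T \<in> bounded_ops \<Longrightarrow> c *\<^sub>R T \<in> bounded_ops"
  by (simp add: scaleR_scaleC bounded_ops_scaleC)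

lemma bounded_ops_compose: "S \<in> bounded_ops \<Longrightarrow> T \<in> bounded_ops \<Longrightarrow> S o\<^sub>L T \<in> bounded_ops"
  by (simp add: bounded_ops_def)

lemma subspace_bounded_ops: "complex_vector.subspace bounded_ops"
  unfolding complex_vector.subspace_def
  by (intro conjI ballI allI bounded_ops_add bounded_ops_scaleC) (simp_all add: bounded_ops_def)

lemma bounded_linear_scaleC: "bounded_linear (\<lambda>x::'a::complex_inner. c *\<^sub>C x)"
  by (rule bounded_linear_intro[where K = "cmod c"])
    (auto simp: scaleC_add_right norm_scaleC scaleR_scaleC scaleC_scaleC mult.commute)

lemma closed_bounded_ops: "closed (bounded_ops :: ('a::chilbert_space \<Rightarrow>\<^sub>L 'b::chilbert_space) set)"
proof -
  have "bounded_ops = (\<Inter>c. \<Inter>x. {T :: 'a \<Rightarrow>\<^sub>L 'b. T (c *\<^sub>C x) = c *\<^sub>C T x})"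
    by (auto simp: bounded_ops_def)
  moreover have "closed {T :: 'a \<Rightarrow>\<^sub>L 'b. T (c *\<^sub>C x) = c *\<^sub>C T x}" for c x
    by (intro closed_Collect_eq continuous_intros
        bounded_linear.continuous_on[OF bounded_linear_scaleC])
  then have "closed (\<Inter>c. \<Inter>x. {T :: 'a \<Rightarrow>\<^sub>L 'b. T (c *\<^sub>C x) = c *\<^sub>C T x})"
    by (intro closed_INT ballI)
  ultimately show ?thesis by simp
qed

lemma cstar_subalgebra_bounded_ops: "cstar_subalgebra bounded_ops"
  by (simp add: cstar_subalgebra_def subspace_bounded_ops closed_bounded_ops bounded_ops_compose
      adj_bounded_ops)

lemma cstar_subalgebra_cstar_generated:
  assumes "M \<subseteq> bounded_ops"
  shows "cstar_subalgebra (cstar_generated M)"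
proof -
  let ?F = "{A. cstar_subalgebra A \<and> M \<subseteq> A}"
  \<comment> \<open>An empty family would intersect to the whole type, with the merely real-linear
    maps included.\<close>
  have "bounded_ops \<in> ?F"
    using assms cstar_subalgebra_bounded_ops by simp
  then have "\<Inter>?F \<subseteq> bounded_ops" by blast
  moreover have "complex_vector.subspace (\<Inter>?F)"
    by (rule complex_vector.subspace_Inter) (simp add: cstar_subalgebra_def)
  moreover have "closed (\<Inter>?F)"
    by (rule closed_Inter) (simp add: cstar_subalgebra_def)
  ultimately show ?thesis
    by (simp add: cstar_generated_def hull_def cstar_subalgebra_def)
qed

section \<open>Contractive homomorphisms of C*-algebras\<close>

text \<open>This is T^2 <= T for 0 <= T <= 1, obtained without a square root: test positivity at x -
  T x and use the upper bound at T x.\<close>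

lemma norm_sq_le_form:
  fixes T :: "'a::real_inner \<Rightarrow>\<^sub>L 'a"
  assumes sym: "\<And>x y. inner (T x) y = inner x (T y)"
    and pos: "\<And>x. inner (T x) x \<ge> 0" and le: "\<And>x. inner (T x) x \<le> (norm x)\<^sup>2"
  shows "(norm (T x))\<^sup>2 \<le> inner (T x) x"
proof -
  have "0 \<le> inner (T (x - T x)) (x - T x)" by (rule pos)
  also have "\<dots> = inner (T x) x - 2 * (norm (T x))\<^sup>2 + inner (T (T x)) (T x)"
    by (simp add: blinfun.diff_right inner_diff_left inner_diff_right sym[of "T x" x] power2_norm_eq_inner)
  also have "\<dots> \<le> inner (T x) x - (norm (T x))\<^sup>2"
    using le[of "T x"] by simp
  finally show ?thesis by simp
qed

text \<open>\<open>a o\<^sub>L approx_unit_quot a n\<close> is $1 - (1 - a^2)^n$, an approximate unit for the algebra generated by a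
  self-adjoint contraction $a$; \<open>approx_unit_rest a n\<close> is $(1 - a^2)^n$.\<close>

primrec approx_unit_quot :: "('a::real_normed_vector \<Rightarrow>\<^sub>L 'a) \<Rightarrow> nat \<Rightarrow> ('a \<Rightarrow>\<^sub>L 'a)" where
  "approx_unit_quot a 0 = 0"
| "approx_unit_quot a (Suc n) = approx_unit_quot a n + a - (a o\<^sub>L (a o\<^sub>L approx_unit_quot a n))"

definition approx_unit_rest :: "('a::real_normed_vector \<Rightarrow>\<^sub>L 'a) \<Rightarrow> nat \<Rightarrow> ('a \<Rightarrow>\<^sub>L 'a)" where
  "approx_unit_rest a n = id_blinfun - (a o\<^sub>L approx_unit_quot a n)"

lemma approx_unit_quot_commute:
  "a o\<^sub>L approx_unit_quot a n = approx_unit_quot a n o\<^sub>L a"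
proof (induction n)
  case (Suc n)
  then have *: "a (approx_unit_quot a n x) = approx_unit_quot a n (a x)" for x
    by (metis blinfun_apply_blinfun_compose)
  show ?case
    by (rule blinfun_eqI)
      (simp add: blinfun.add_left blinfun.add_right blinfun.diff_left blinfun.diff_right *)
qed (rule blinfun_eqI, simp)

lemma approx_unit_rest_0 [simp]: "approx_unit_rest a 0 x = x"
  by (simp add: approx_unit_rest_def blinfun.diff_left)

lemma approx_unit_rest_Suc:
  "approx_unit_rest a (Suc n) x = approx_unit_rest a n x - a (a (approx_unit_rest a n x))"
  by (simp add: approx_unit_rest_def blinfun.diff_left blinfun.diff_right blinfun.add_left blinfun.add_right)

lemma approx_unit_rest_commute:
  "approx_unit_rest a n (a x) = a (approx_unit_rest a n x)"
  by (induction n) (simp_all add: approx_unit_rest_Suc blinfun.diff_right)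

lemma approx_unit_rest_add:
  "approx_unit_rest a (m + n) x = approx_unit_rest a m (approx_unit_rest a n x)"
  by (induction m) (simp_all add: approx_unit_rest_Suc)

lemma approx_unit_rest_sym:
  fixes a :: "'a::real_inner \<Rightarrow>\<^sub>L 'a"
  assumes sym: "\<And>x y. inner (a x) y = inner x (a y)"
  shows "inner (approx_unit_rest a n x) y = inner x (approx_unit_rest a n y)"
  by (induction n arbitrary: x y)
    (simp_all add: approx_unit_rest_Suc inner_diff_left inner_diff_right sym approx_unit_rest_commute)

text \<open>Expand the square and use |a a v| <= |a v|. The loss |a v|^2 is kept because its sum
  over the steps gives the rate in \<open>approx_unit_rest_contraction\<close>.\<close>

lemma approx_unit_step:
  fixes a :: "'a::real_inner \<Rightarrow>\<^sub>L 'a"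
  assumes sym: "\<And>x y. inner (a x) y = inner x (a y)" and "norm a \<le> 1"
  shows "(norm (v - a (a v)))\<^sup>2 \<le> (norm v)\<^sup>2 - (norm (a v))\<^sup>2"
proof -
  have "norm (a (a v)) \<le> 1 * norm (a v)"
    using norm_blinfun[of a "a v"] mult_right_mono[OF assms(2), of "norm (a v)"] by simp
  then have "(norm (a (a v)))\<^sup>2 \<le> (norm (a v))\<^sup>2" by (simp add: power_mono)
  moreover have "(norm (v - a (a v)))\<^sup>2 = (norm v)\<^sup>2 - 2 * (norm (a v))\<^sup>2 + (norm (a (a v)))\<^sup>2"
    by (simp add: power2_norm_eq_inner inner_diff_left inner_diff_right sym[of "a v" v]
        sym[of v "a v", symmetric])
  ultimately show ?thesis by simp
qed

text \<open>The second bound adds up the losses in \<open>approx_unit_step\<close>: the values |a (1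
  - a^2)^k x|^2 decrease in k, so each loss before step n dominates the value at n, and the sum
  telescopes.\<close>

lemma approx_unit_rest_contraction:
  fixes a :: "'a::real_inner \<Rightarrow>\<^sub>L 'a"
  assumes sym: "\<And>x y. inner (a x) y = inner x (a y)" and "norm a \<le> 1"
  shows "norm (approx_unit_rest a n x) \<le> norm x"
    and "real n * (norm (a (approx_unit_rest a n x)))\<^sup>2 \<le> (norm x)\<^sup>2 - (norm (approx_unit_rest a n x))\<^sup>2"
proof -
  note step = approx_unit_step[OF assms]
  show b: "real n * (norm (a (approx_unit_rest a n x)))\<^sup>2 \<le> (norm x)\<^sup>2 - (norm (approx_unit_rest a n x))\<^sup>2"
  proof (induction n)
    case (Suc n)
    let ?v = "approx_unit_rest a n x"
    have "a (approx_unit_rest a (Suc n) x) = a ?v - a (a (a ?v))"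
      by (simp add: approx_unit_rest_Suc blinfun.diff_right)
    then have "(norm (a (approx_unit_rest a (Suc n) x)))\<^sup>2 \<le> (norm (a ?v))\<^sup>2"
      using step[of "a ?v"] by (smt (verit) zero_le_power2)
    then have "real (Suc n) * (norm (a (approx_unit_rest a (Suc n) x)))\<^sup>2 \<le> real (Suc n) * (norm (a ?v))\<^sup>2"
      by (rule mult_left_mono) simp
    also have "\<dots> \<le> (norm x)\<^sup>2 - (norm ?v)\<^sup>2 + (norm (a ?v))\<^sup>2"
      using Suc.IH by (simp add: algebra_simps)
    also have "\<dots> \<le> (norm x)\<^sup>2 - (norm (approx_unit_rest a (Suc n) x))\<^sup>2"
      using step[of ?v] by (simp add: approx_unit_rest_Suc)
    finally show ?case .
  qed simp
  have "0 \<le> real n * (norm (a (approx_unit_rest a n x)))\<^sup>2" by simp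
  then have "(norm (approx_unit_rest a n x))\<^sup>2 \<le> (norm x)\<^sup>2" using b by linarith
  then show "norm (approx_unit_rest a n x) \<le> norm x"
    by (rule power2_le_imp_le) simp
qed

text \<open>With exponent n + n the remainder is the square of a self-adjoint operator, so the form
  of T = 1 - (1 - a^2)^(2n) at y is |y|^2 - |(1 - a^2)^n y|^2. This shows 0 <= T <= 1, and
  \<open>norm_sq_le_form\<close> applies.\<close>

lemma norm_approx_unit_le:
  fixes a :: "'a::real_inner \<Rightarrow>\<^sub>L 'a"
  assumes sym: "\<And>x y. inner (a x) y = inner x (a y)" and "norm a \<le> 1"
  shows "norm ((a o\<^sub>L approx_unit_quot a (n + n)) x) \<le> norm x"
proof -
  let ?T = "a o\<^sub>L approx_unit_quot a (n + n)"
  have T: "?T y = y - approx_unit_rest a (n + n) y" for y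
    by (simp add: approx_unit_rest_def blinfun.diff_left)
  have form: "inner (?T y) y = (norm y)\<^sup>2 - (norm (approx_unit_rest a n y))\<^sup>2" for y
    by (simp only: T inner_diff_left approx_unit_rest_add approx_unit_rest_sym[OF sym] power2_norm_eq_inner)
  have "(norm (?T x))\<^sup>2 \<le> inner (?T x) x"
  proof (rule norm_sq_le_form)
    show "inner (?T x) y = inner x (?T y)" for x y
      by (simp only: T inner_diff_left inner_diff_right approx_unit_rest_sym[OF sym])
    show "0 \<le> inner (?T y) y" for y
      using approx_unit_rest_contraction(1)[OF assms, of n y] unfolding form by (simp add: power_mono)
    show "inner (?T y) y \<le> (norm y)\<^sup>2" for y
      unfolding form by simp
  qed
  also have "\<dots> \<le> (norm x)\<^sup>2" unfolding form by simp
  finally show ?thesis by (rule power2_le_imp_le) simp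
qed

text \<open>The difference is a (1 - a^2)^n, to which the rate in
  \<open>approx_unit_rest_contraction\<close> applies.\<close>

lemma norm_diff_approx_unit_le:
  fixes a :: "'a::real_inner \<Rightarrow>\<^sub>L 'a"
  assumes sym: "\<And>x y. inner (a x) y = inner x (a y)" and "norm a \<le> 1" and "n > 0"
  shows "norm (a - (a o\<^sub>L (a o\<^sub>L approx_unit_quot a n))) \<le> 1 / sqrt (real n)"
proof (rule norm_blinfun_bound)
  fix x
  have "real n * (norm (a (approx_unit_rest a n x)))\<^sup>2 \<le> (norm x)\<^sup>2"
    using approx_unit_rest_contraction(2)[OF assms(1,2), of n x] by (smt (verit) zero_le_power2)
  then have "(sqrt (real n) * norm (a (approx_unit_rest a n x)))\<^sup>2 \<le> (norm x)\<^sup>2"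
    by (simp add: power_mult_distrib)
  then have "sqrt (real n) * norm (a (approx_unit_rest a n x)) \<le> norm x"
    by (rule power2_le_imp_le) simp
  moreover have "(a - (a o\<^sub>L (a o\<^sub>L approx_unit_quot a n))) x = a (approx_unit_rest a n x)"
    by (simp add: approx_unit_rest_def blinfun.diff_left blinfun.diff_right)
  ultimately show "norm ((a - (a o\<^sub>L (a o\<^sub>L approx_unit_quot a n))) x) \<le> 1 / sqrt (real n) * norm x"
    using assms(3) by (simp add: field_simps)
qed simp

section \<open>From contractive homomorphisms to preservation of adjoints\<close>

lemma cstar_subalgebraD:
  assumes "cstar_subalgebra A"
  shows "A \<subseteq> bounded_ops" "0 \<in> A"
    "\<And>a b. a \<in> A \<Longrightarrow> b \<in> A \<Longrightarrow> a + b \<in> A" "\<And>a b. a \<in> A \<Longrightarrow> b \<in> A \<Longrightarrow> a - b \<in> A"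
    "\<And>c a. a \<in> A \<Longrightarrow> c *\<^sub>C a \<in> A" "\<And>c a. a \<in> A \<Longrightarrow> c *\<^sub>R a \<in> A"
    "\<And>a b. a \<in> A \<Longrightarrow> b \<in> A \<Longrightarrow> a o\<^sub>L b \<in> A" "\<And>a. a \<in> A \<Longrightarrow> adj a \<in> A"
  using assms unfolding cstar_subalgebra_def
  by (auto simp: complex_vector.subspace_0 complex_vector.subspace_add complex_vector.subspace_diff
      complex_vector.subspace_scale scaleR_scaleC)

lemma clinear_into_opsD:
  assumes "clinear_into_ops S f"
  shows "\<And>a. a \<in> S \<Longrightarrow> f a \<in> bounded_ops"
    "\<And>a b. a \<in> S \<Longrightarrow> b \<in> S \<Longrightarrow> f (a + b) = f a + f b"
    "\<And>c a. a \<in> S \<Longrightarrow> f (c *\<^sub>C a) = c *\<^sub>C f a"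
    "\<And>c a. a \<in> S \<Longrightarrow> f (c *\<^sub>R a) = c *\<^sub>R f a"
  using assms unfolding clinear_into_ops_def by (auto simp: scaleR_scaleC)

lemma clinear_into_ops_diff:
  assumes "clinear_into_ops S f" "complex_vector.subspace S" "a \<in> S" "b \<in> S"
  shows "f (a - b) = f a - f b"
proof -
  have "f (a - b + b) = f (a - b) + f b"
    using assms by (intro clinear_into_opsD(2)[OF assms(1)] complex_vector.subspace_diff)
  then show ?thesis by simp
qed

lemma approx_unit_quot_mem:
  assumes "cstar_subalgebra A" "a \<in> A"
  shows "approx_unit_quot a n \<in> A"
  by (induction n) (simp_all add: assms cstar_subalgebraD[OF assms(1)])

lemma op_homD:
  assumes "op_hom A f"
  shows "clinear_into_ops A f" "\<And>a b. a \<in> A \<Longrightarrow> b \<in> A \<Longrightarrow> f (a o\<^sub>L b) = f a o\<^sub>L f b"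
  using assms by (auto simp: op_hom_def)

lemma subspace_cstar_subalgebra: "cstar_subalgebra A \<Longrightarrow> complex_vector.subspace A"
  by (simp add: cstar_subalgebra_def)

text \<open>The operators \<open>p n\<close> approximate the identity only on the range of
  \<open>b\<close>, and \<open>f\<close> is not yet known to respect adjoints. Symmetry of
  \<open>b\<close> is therefore proved in three stages: with both arguments in the range of
  \<open>b\<close>, then with one, then with none.\<close>

lemma contractive_hom_selfadjoint_unit:
  fixes A :: "('a::chilbert_space \<Rightarrow>\<^sub>L 'a) set"
    and f :: "('a \<Rightarrow>\<^sub>L 'a) \<Rightarrow> ('b::chilbert_space \<Rightarrow>\<^sub>L 'b)"
  assumes A: "cstar_subalgebra A" and hom: "op_hom A f" and contr: "contractive A f"
    and a: "a \<in> A" and sym: "\<And>x y. inner (a x) y = inner x (a y)" and na: "norm a \<le> 1"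
  shows "inner (f a x) y = inner x (f a y)"
proof -
  note lin = op_homD(1)[OF hom] and mult = op_homD(2)[OF hom] and Aop = cstar_subalgebraD[OF A]
  define b where "b = f a"
  \<comment> \<open>The index is even for \<open>norm_approx_unit_le\<close> and positive for
    \<open>norm_diff_approx_unit_le\<close>.\<close>
  define d where "d n = approx_unit_quot a (Suc n + Suc n)" for n
  define e where "e n = f (d n)" for n
  define p where "p n = f (a o\<^sub>L d n)" for n
  have dA: "d n \<in> A" for n unfolding d_def by (rule approx_unit_quot_mem[OF A a])
  have cA: "a o\<^sub>L d n \<in> A" "a o\<^sub>L (a o\<^sub>L d n) \<in> A" for n using a dA Aop by auto
  have bops: "b \<in> bounded_ops" using clinear_into_opsD(1)[OF lin a] by (simp add: b_def)
  have pops: "p n \<in> bounded_ops" for n using clinear_into_opsD(1)[OF lin cA(1)] by (simp add: p_def)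
  have p1: "p n = b o\<^sub>L e n" for n by (simp add: p_def b_def e_def mult a dA)
  have p2: "p n = e n o\<^sub>L b" for n
  proof -
    have "a o\<^sub>L d n = d n o\<^sub>L a" unfolding d_def by (rule approx_unit_quot_commute)
    then show ?thesis by (simp add: p_def b_def e_def mult a dA)
  qed
  have be: "b (e n x) = p n x" and eb: "e n (b x) = p n x" for n x
    by (simp add: p1) (simp add: p2)
  have bp: "b (p n x) = p n (b x)" for n x
    by (metis be eb)
  have nd: "norm ((a o\<^sub>L d n) x) \<le> norm x" for n x
    unfolding d_def by (rule norm_approx_unit_le[OF sym na])
  have nc: "norm (a o\<^sub>L d n) \<le> 1" for n
    by (rule norm_blinfun_bound) (use nd in simp_all)
  have np: "norm (p n) \<le> 1" for n
    using contr nc[of n] cA(1)[of n] unfolding contractive_def p_def by (meson order_trans)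
  have np': "norm (p n x) \<le> norm x" for n x
    using norm_blinfun[of "p n" x] mult_right_mono[OF np[of n], of "norm x"] by simp
  have lim_b: "(\<lambda>n. b (p n x)) \<longlonglongrightarrow> b x" for x
  proof -
    have bound: "norm (b (p n x) - b x) \<le> inverse (sqrt (real (Suc n))) * norm x" for n
    proof -
      have "b (p n x) - b x = - f (a - (a o\<^sub>L (a o\<^sub>L d n))) x"
        by (subst clinear_into_ops_diff[OF lin subspace_cstar_subalgebra[OF A] a cA(2)])
          (simp add: mult a cA b_def p_def blinfun.diff_left)
      also have "norm \<dots> \<le> norm (f (a - (a o\<^sub>L (a o\<^sub>L d n)))) * norm x"
        by (simp add: norm_blinfun)
      also have "norm (f (a - (a o\<^sub>L (a o\<^sub>L d n)))) \<le> norm (a - (a o\<^sub>L (a o\<^sub>L d n)))"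
        using contr a cA Aop unfolding contractive_def by blast
      also have "\<dots> \<le> 1 / sqrt (real (Suc n + Suc n))"
        unfolding d_def by (rule norm_diff_approx_unit_le[OF sym na]) simp
      also have "\<dots> \<le> inverse (sqrt (real (Suc n)))"
        by (simp add: inverse_eq_divide frac_le)
      finally show ?thesis by (simp add: mult_right_mono)
    qed
    have "(\<lambda>n. inverse (sqrt (real (Suc n))) * norm x) \<longlonglongrightarrow> 0 * norm x"
    proof (rule tendsto_mult[OF _ tendsto_const])
      have "(\<lambda>n. sqrt (inverse (real (Suc n)))) \<longlonglongrightarrow> sqrt 0"
        by (rule tendsto_real_sqrt[OF LIMSEQ_inverse_real_of_nat])
      then show "(\<lambda>n. inverse (sqrt (real (Suc n)))) \<longlonglongrightarrow> 0"
        by (simp add: real_sqrt_inverse)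
    qed
    then have "(\<lambda>n. b (p n x) - b x) \<longlonglongrightarrow> 0"
      unfolding mult_zero_left
      by (rule Lim_null_comparison[OF always_eventually, rotated]) (intro allI bound)
    then show ?thesis by (simp add: LIM_zero_iff)
  qed
  have lim_p: "(\<lambda>n. p n (b x)) \<longlonglongrightarrow> b x" for x
    using lim_b[of x] by (simp add: bp)

  \<comment> \<open>The first-order term in \<open>t\<close> of the squared norm of $(1 + itb) \xi$ has to vanish.\<close>
  have skew0: "inner (b \<eta>) (\<i> *\<^sub>C b (b \<eta>)) = 0" for \<eta>
  proof -
    let ?\<xi> = "b \<eta>"
    have ineq: "(norm (?\<xi> + (t *\<^sub>R \<i> *\<^sub>C b ?\<xi>)))\<^sup>2 \<le> (1 + t\<^sup>2) * (norm ?\<xi>)\<^sup>2" for t :: real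
    proof -
      have *: "norm (p n \<xi> + (t *\<^sub>R \<i> *\<^sub>C b (p n \<xi>))) \<le> sqrt (1 + t\<^sup>2) * norm \<xi>" for n \<xi>
      proof -
        \<comment> \<open>\<open>?c\<close> is 1 + i t a times the approximate unit, hence in
          \<open>A\<close>; on the range of \<open>b\<close> its image tends to 1 + i t b. As
          \<open>a\<close> is self-adjoint, the two summands applied to a vector are orthogonal,
          which gives the factor 1 + t^2.\<close>
        let ?c = "(a o\<^sub>L d n) + t *\<^sub>R (\<i> *\<^sub>C (a o\<^sub>L (a o\<^sub>L d n)))"
        have cmem: "?c \<in> A" by (intro Aop(3,5,6) cA)
        have "norm ?c \<le> sqrt (1 + t\<^sup>2)"
        proof (rule norm_blinfun_bound)
          fix x
          let ?z = "(a o\<^sub>L d n) x"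
          have z: "norm ?z \<le> norm x"
            by (rule nd)
          have az: "norm (a ?z) \<le> norm ?z"
            using norm_blinfun[of a ?z] mult_right_mono[OF na, of "norm ?z"] by simp
          have aops: "a \<in> bounded_ops" using a Aop by blast
          have "inner ?z (\<i> *\<^sub>C a ?z) = inner (\<i> *\<^sub>C ?z) (a ?z)"
            by (simp only: bounded_opsD[OF aops, symmetric] sym inner_commute[of ?z])
          also have "\<dots> = - inner ?z (\<i> *\<^sub>C a ?z)"
            by (simp only: inner_scaleC_left complex_cnj_i complex_vector.scale_minus_left inner_minus_right)
          finally have orth: "inner ?z (\<i> *\<^sub>C a ?z) = 0" by simp
          have "(norm (?c x))\<^sup>2 = (norm (?z + t *\<^sub>R (\<i> *\<^sub>C a ?z)))\<^sup>2"
            by (simp add: blinfun.add_left blinfun.scaleR_left)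
          also have "\<dots> = (norm ?z)\<^sup>2 + t\<^sup>2 * (norm (a ?z))\<^sup>2"
            unfolding power2_norm_eq_inner inner_add_left inner_add_right
            using orth inner_commute[of ?z "\<i> *\<^sub>C a ?z"] inner_scaleC_left[of \<i> "a ?z" "\<i> *\<^sub>C a ?z"]
            by (simp add: power2_eq_square[of t])
          also have "\<dots> \<le> (norm ?z)\<^sup>2 + t\<^sup>2 * (norm ?z)\<^sup>2"
            using az by (intro add_left_mono mult_left_mono power_mono) auto
          also have "\<dots> \<le> (1 + t\<^sup>2) * (norm x)\<^sup>2"
            using z by (auto simp: distrib_right intro!: add_mono mult_left_mono power_mono)
          also have "\<dots> = (sqrt (1 + t\<^sup>2) * norm x)\<^sup>2"
            by (simp add: power_mult_distrib)
          finally show "norm (?c x) \<le> sqrt (1 + t\<^sup>2) * norm x"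
            by (rule power2_le_imp_le) simp
        qed simp
        then have "norm (f ?c) \<le> sqrt (1 + t\<^sup>2)"
          using contr cmem unfolding contractive_def by (meson order_trans)
        moreover have "f ?c = p n + t *\<^sub>R (\<i> *\<^sub>C (b o\<^sub>L p n))"
          using cA Aop a by (simp add: clinear_into_opsD[OF lin] mult p_def b_def)
        ultimately show ?thesis
          using norm_blinfun[of "f ?c" \<xi>] mult_right_mono[of "norm (f ?c)" "sqrt (1 + t\<^sup>2)" "norm \<xi>"]
          by (simp add: blinfun.add_left blinfun.scaleR_left)
      qed
      have "(\<lambda>n. norm (p n ?\<xi> + (t *\<^sub>R \<i> *\<^sub>C b (p n ?\<xi>)))) \<longlonglongrightarrow> norm (?\<xi> + (t *\<^sub>R \<i> *\<^sub>C b ?\<xi>))"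
        by (intro tendsto_norm tendsto_add tendsto_scaleR tendsto_const lim_p lim_b
            bounded_linear.tendsto[OF bounded_linear_scaleC])
      then have "norm (?\<xi> + (t *\<^sub>R \<i> *\<^sub>C b ?\<xi>)) \<le> sqrt (1 + t\<^sup>2) * norm ?\<xi>"
        by (rule LIMSEQ_le_const2) (use * in blast)
      then have "(norm (?\<xi> + (t *\<^sub>R \<i> *\<^sub>C b ?\<xi>)))\<^sup>2 \<le> (sqrt (1 + t\<^sup>2) * norm ?\<xi>)\<^sup>2"
        by (rule power_mono) simp
      then show ?thesis by (simp add: power_mult_distrib)
    qed
    define s where "s = inner ?\<xi> (\<i> *\<^sub>C b ?\<xi>)"
    define q where "q = (norm ?\<xi>)\<^sup>2"
    have lin_le: "2 * t * s \<le> t\<^sup>2 * q" for t :: real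
    proof -
      have "(norm (?\<xi> + (t *\<^sub>R \<i> *\<^sub>C b ?\<xi>)))\<^sup>2
          = q + 2 * t * s + t\<^sup>2 * (norm (\<i> *\<^sub>C b ?\<xi>))\<^sup>2"
        unfolding q_def s_def power2_norm_eq_inner
        by (simp add: inner_add_left inner_add_right inner_commute power2_eq_square[of t])
      moreover have "t\<^sup>2 * (norm (\<i> *\<^sub>C b ?\<xi>))\<^sup>2 \<ge> 0" by simp
      moreover have "(1 + t\<^sup>2) * (norm ?\<xi>)\<^sup>2 = q + t\<^sup>2 * q" by (simp add: q_def distrib_right)
      ultimately show ?thesis using ineq[of t] by linarith
    qed
    have "s = 0"
    proof (rule ccontr)
      assume "s \<noteq> 0"
      \<comment> \<open>Same sign as \<open>s\<close>, with q + 1 to cover \<open>q = 0\<close>;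
        inserted into \<open>lin_le\<close> it yields 2 s^2 (q + 1) <= s^2 q.\<close>
      define t where "t = s / (q + 1)"
      have q: "q \<ge> 0" by (simp add: q_def)
      have "2 * s\<^sup>2 / (q + 1) \<le> s\<^sup>2 * q / (q + 1)\<^sup>2"
        using lin_le[of t] by (simp add: t_def power2_eq_square)
      then have "2 * s\<^sup>2 * (q + 1) \<le> s\<^sup>2 * q"
        using q by (simp add: divide_simps power2_eq_square split: if_splits)
      moreover have "s\<^sup>2 * q \<ge> 0" "s\<^sup>2 > 0" using q \<open>s \<noteq> 0\<close> by auto
      ultimately show False by (simp add: algebra_simps)
    qed
    then show ?thesis by (simp add: s_def)
  qed
  have sym_range: "inner (b (b u)) (b v) = inner (b u) (b (b v))" for u v
  proof -
    have polar: "inner (b u) (\<i> *\<^sub>C b (b v)) + inner (b v) (\<i> *\<^sub>C b (b u)) = 0" for u v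
      using skew0[of "u + v"] skew0[of u] skew0[of v]
      by (simp add: blinfun.add_right scaleC_add_right inner_add_left inner_add_right)
    \<comment> \<open>Replacing u by i u absorbs the factor i and turns the polarized relation into
      symmetry.\<close>
    have "inner (\<i> *\<^sub>C b u) (\<i> *\<^sub>C b (b v)) + inner (b v) (\<i> *\<^sub>C \<i> *\<^sub>C b (b u)) = 0"
      using polar[of "\<i> *\<^sub>C u" v] by (simp only: bounded_opsD[OF bops])
    then show ?thesis
      by (simp add: inner_scaleC_left inner_commute)
  qed

  \<comment> \<open>The adjoint of a contraction almost fixes every vector which the contraction almost fixes.\<close>
  have adj_lim: "(\<lambda>n. inner (p n x) (b u)) \<longlonglongrightarrow> inner x (b u)" for x u
  proof -
    let ?\<xi> = "b u"
    let ?q = "\<lambda>n. adj (p n) ?\<xi>"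
    have bound: "(norm (?q n - ?\<xi>))\<^sup>2 \<le> 2 * (norm ?\<xi>)\<^sup>2 - 2 * inner ?\<xi> (p n ?\<xi>)" for n
    proof -
      have "norm (adj (p n)) \<le> 1" using norm_adj_le[OF pops] np by (rule order_trans)
      then have "norm (?q n) \<le> norm ?\<xi>"
        using norm_blinfun[of "adj (p n)" ?\<xi>] mult_right_mono[of "norm (adj (p n))" 1 "norm ?\<xi>"] by simp
      then have "(norm (?q n))\<^sup>2 \<le> (norm ?\<xi>)\<^sup>2" by (simp add: power_mono)
      moreover have "inner ?\<xi> (p n ?\<xi>) = inner (?q n) ?\<xi>" by (rule inner_adj'[OF pops])
      ultimately show ?thesis
        by (simp add: power2_norm_eq_inner inner_diff_left inner_diff_right inner_commute)
    qed
    have "(\<lambda>n. 2 * (norm ?\<xi>)\<^sup>2 - 2 * inner ?\<xi> (p n ?\<xi>))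
        \<longlonglongrightarrow> 2 * (norm ?\<xi>)\<^sup>2 - 2 * inner ?\<xi> ?\<xi>"
      by (intro tendsto_diff tendsto_mult tendsto_inner tendsto_const lim_p)
    then have upper: "(\<lambda>n. 2 * (norm ?\<xi>)\<^sup>2 - 2 * inner ?\<xi> (p n ?\<xi>)) \<longlonglongrightarrow> 0"
      by (simp only: power2_norm_eq_inner diff_self)
    have "(\<lambda>n. (norm (?q n - ?\<xi>))\<^sup>2) \<longlonglongrightarrow> 0"
      by (rule Lim_null_comparison[OF always_eventually upper]) (use bound in simp)
    from tendsto_real_sqrt[OF this] have "(\<lambda>n. norm (?q n - ?\<xi>)) \<longlonglongrightarrow> 0"
      by simp
    then have "(\<lambda>n. ?q n - ?\<xi>) \<longlonglongrightarrow> 0"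
      by (simp add: tendsto_norm_zero_iff)
    then have "?q \<longlonglongrightarrow> ?\<xi>" by (simp add: LIM_zero_iff)
    then have "(\<lambda>n. inner x (?q n)) \<longlonglongrightarrow> inner x ?\<xi>"
      by (intro tendsto_inner tendsto_const)
    then show ?thesis by (simp add: inner_adj[OF pops])
  qed
  \<comment> \<open>As \<open>p n u\<close> equals \<open>b (e n u)\<close>,
    \<open>sym_range\<close> applies to it. In the limit the first argument leaves the range of
    \<open>b\<close>, because \<open>p n u\<close> tends to \<open>u\<close> when tested against
    vectors of that range.\<close>
  have sym_right: "inner (b u) (b v) = inner u (b (b v))" for u v
  proof (rule LIMSEQ_unique)
    show "(\<lambda>n. inner (b (p n u)) (b v)) \<longlonglongrightarrow> inner (b u) (b v)"
      by (intro tendsto_inner tendsto_const lim_b)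
    have "inner (b (p n u)) (b v) = inner (p n u) (b (b v))" for n
      using sym_range[of "e n u" v] by (simp only: be)
    then show "(\<lambda>n. inner (b (p n u)) (b v)) \<longlonglongrightarrow> inner u (b (b v))"
      using adj_lim[of u "b v"] by simp
  qed
  \<comment> \<open>The same replacement frees the remaining argument, with \<open>sym_right\<close>
    in place of \<open>sym_range\<close>.\<close>
  have "inner (b x) y = inner x (b y)"
  proof (rule LIMSEQ_unique)
    show "(\<lambda>n. inner (b (p n x)) y) \<longlonglongrightarrow> inner (b x) y"
      by (intro tendsto_inner tendsto_const lim_b)
    have "inner (b (p n x)) y = inner (p n x) (b y)" for n
      using sym_right[of y "e n x"] by (simp add: be inner_commute)
    then show "(\<lambda>n. inner (b (p n x)) y) \<longlonglongrightarrow> inner x (b y)"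
      using adj_lim[of x y] by simp
  qed
  then show ?thesis by (simp add: b_def)
qed

lemma contractive_hom_selfadjoint:
  fixes A :: "('a::chilbert_space \<Rightarrow>\<^sub>L 'a) set"
    and f :: "('a \<Rightarrow>\<^sub>L 'a) \<Rightarrow> ('b::chilbert_space \<Rightarrow>\<^sub>L 'b)"
  assumes A: "cstar_subalgebra A" and hom: "op_hom A f" and contr: "contractive A f"
    and a: "a \<in> A" and sym: "\<And>x y. inner (a x) y = inner x (a y)"
  shows "inner (f a x) y = inner x (f a y)"
proof (cases "norm a = 0")
  case True
  then have "f a = 0"
    using contr a unfolding contractive_def by fastforce
  then show ?thesis by simp
next
  case False
  let ?a = "(1 / norm a) *\<^sub>R a"
  have "inner (f ?a x) y = inner x (f ?a y)"
    by (rule contractive_hom_selfadjoint_unit[OF A hom contr])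
      (use a cstar_subalgebraD(6)[OF A] sym False in \<open>simp_all add: blinfun.scaleR_left\<close>)
  then show ?thesis
    using False clinear_into_opsD(4)[OF op_homD(1)[OF hom] a, of "1 / norm a"]
    by (simp add: blinfun.scaleR_left)
qed

lemma contractive_hom_imp_star_hom:
  fixes A :: "('a::chilbert_space \<Rightarrow>\<^sub>L 'a) set"
    and f :: "('a \<Rightarrow>\<^sub>L 'a) \<Rightarrow> ('b::chilbert_space \<Rightarrow>\<^sub>L 'b)"
  assumes A: "cstar_subalgebra A" and hom: "op_hom A f" and contr: "contractive A f"
  shows "star_hom A f"
proof -
  note lin = op_homD(1)[OF hom] and Aop = cstar_subalgebraD[OF A]
  have "f (adj a) = adj (f a)" if a: "a \<in> A" for a
  proof -
    \<comment> \<open>Twice the real part and minus twice the imaginary part of \<open>a\<close>,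
      both self-adjoint.\<close>
    let ?h = "a + adj a" and ?k = "\<i> *\<^sub>C (a - adj a)"
    have aops: "a \<in> bounded_ops" using a Aop(1) by blast
    have mem: "?h \<in> A" "?k \<in> A" "adj a \<in> A" by (intro Aop(3,4,5,8) a)+
    have fops: "f a \<in> bounded_ops" "f (adj a) \<in> bounded_ops"
      using clinear_into_opsD(1)[OF lin] a mem by auto
    have "inner (?h x) y = inner x (?h y)" for x y
      by (simp add: blinfun.add_left inner_add_left inner_add_right inner_adj[OF aops] inner_adj'[OF aops])
    then have "inner (f ?h x) y = inner x (f ?h y)" for x y
      by (rule contractive_hom_selfadjoint[OF A hom contr mem(1)])
    then have h: "inner (f a x) y + inner (f (adj a) x) y = inner x (f a y) + inner x (f (adj a) y)" for x y
      using a mem by (simp add: clinear_into_opsD(2)[OF lin] blinfun.add_left inner_add_left inner_add_right)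
    have "inner (?k x) y = inner x (?k y)" for x y
    proof -
      have "inner (?k x) y = inner ((a - adj a) x) (- (\<i> *\<^sub>C y))"
        by (simp add: inner_scaleC_left)
      also have "\<dots> = inner x ((a - adj a) (\<i> *\<^sub>C y))"
        by (simp add: blinfun.diff_left inner_diff_left inner_diff_right inner_adj[OF aops] inner_adj'[OF aops])
      also have "\<dots> = inner x (?k y)"
        by (simp add: bounded_opsD[OF bounded_ops_diff[OF aops adj_bounded_ops[OF aops]]])
      finally show ?thesis .
    qed
    then have "inner (f ?k x) y = inner x (f ?k y)" for x y
      by (rule contractive_hom_selfadjoint[OF A hom contr mem(2)])
    moreover have "f ?k = \<i> *\<^sub>C (f a - f (adj a))"
      using a mem Aop
      by (simp add: clinear_into_opsD(3)[OF lin] clinear_into_ops_diff[OF lin subspace_cstar_subalgebra[OF A]])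
    ultimately have k: "inner (\<i> *\<^sub>C (f a x - f (adj a) x)) y = inner x (\<i> *\<^sub>C (f a y - f (adj a) y))" for x y
      by (simp add: blinfun.diff_left)
    \<comment> \<open>Testing against i y removes the factor i; adding the result to
      \<open>h\<close> leaves 2 <f a x, y> = 2 <x, f (adj a) y>.\<close>
    have k': "inner (f a x) y - inner (f (adj a) x) y = inner x (f (adj a) y) - inner x (f a y)" for x y
      using k[of x "\<i> *\<^sub>C y"]
      by (simp add: bounded_opsD[OF fops(1)] bounded_opsD[OF fops(2)] inner_scaleC_left
          scaleC_diff_right inner_diff_left inner_diff_right)
    have "inner (f a x) y = inner x (f (adj a) y)" for x y
      using h[of x y] k'[of x y] by simp
    from adj_eqI[OF fops(1) this] show ?thesis by simp
  qed
  then show ?thesis using hom by (simp add: star_hom_def)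
qed

section \<open>Matrices of operators\<close>

definition vec_norm :: "nat \<Rightarrow> (nat \<Rightarrow> 'a::real_normed_vector) \<Rightarrow> real" where
  "vec_norm n x = L2_set (\<lambda>i. norm (x i)) {..<n}"

definition vec_inner :: "nat \<Rightarrow> (nat \<Rightarrow> 'a::real_inner) \<Rightarrow> (nat \<Rightarrow> 'a) \<Rightarrow> real" where
  "vec_inner n x y = (\<Sum>i<n. inner (x i) (y i))"

definition mat_app ::
    "nat \<Rightarrow> (nat \<Rightarrow> nat \<Rightarrow> 'a::real_normed_vector \<Rightarrow>\<^sub>L 'b::real_normed_vector) \<Rightarrow> (nat \<Rightarrow> 'a) \<Rightarrow> nat \<Rightarrow> 'b" where
  "mat_app n A x i = (\<Sum>j<n. A i j (x j))"

lemma vec_norm_nonneg [simp]: "0 \<le> vec_norm n x"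
  by (simp add: vec_norm_def)

lemma vec_norm_sq: "(vec_norm n x)\<^sup>2 = vec_inner n x x"
  by (simp add: vec_norm_def L2_set_def vec_inner_def sum_nonneg power2_norm_eq_inner)

lemma vec_norm_scaleR: "vec_norm n (\<lambda>i. c *\<^sub>R x i) = \<bar>c\<bar> * vec_norm n x"
  by (simp add: vec_norm_def L2_set_right_distrib)

lemma vec_inner_commute: "vec_inner n x y = vec_inner n y x"
  by (simp add: vec_inner_def inner_commute)

lemma vec_inner_diff_left: "vec_inner n (\<lambda>i. x i - y i) z = vec_inner n x z - vec_inner n y z"
  by (simp add: vec_inner_def inner_diff_left sum_subtractf)

lemma vec_inner_diff_right: "vec_inner n z (\<lambda>i. x i - y i) = vec_inner n z x - vec_inner n z y"
  by (simp add: vec_inner_def inner_diff_right sum_subtractf)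

lemma vec_inner_le: "\<bar>vec_inner n x y\<bar> \<le> vec_norm n x * vec_norm n y"
proof -
  have "\<bar>vec_inner n x y\<bar> \<le> (\<Sum>i<n. \<bar>inner (x i) (y i)\<bar>)"
    unfolding vec_inner_def by (rule sum_abs)
  also have "\<dots> \<le> (\<Sum>i<n. \<bar>norm (x i)\<bar> * \<bar>norm (y i)\<bar>)"
    by (rule sum_mono) (simp add: Cauchy_Schwarz_ineq2)
  also have "\<dots> \<le> vec_norm n x * vec_norm n y"
    unfolding vec_norm_def by (rule L2_set_mult_ineq)
  finally show ?thesis .
qed

lemma mat_app_scaleR: "mat_app n A (\<lambda>i. c *\<^sub>R x i) i = c *\<^sub>R mat_app n A x i"
  by (simp add: mat_app_def blinfun.scaleR_right scaleR_sum_right)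

lemma mat_app_diff: "mat_app n A (\<lambda>i. x i - y i) i = mat_app n A x i - mat_app n A y i"
  by (simp add: mat_app_def blinfun.diff_right sum_subtractf)

text \<open>A crude bound that makes the real supremum in \<open>mat_norm\<close> bounded above and
  gives 0 on vectors of norm 0, which cannot be normalized.\<close>

lemma mat_app_bounded:
  "vec_norm n (mat_app n A x) \<le> (\<Sum>i<n. \<Sum>j<n. norm (A i j)) * vec_norm n x"
proof -
  have "vec_norm n (mat_app n A x) \<le> (\<Sum>i<n. norm (mat_app n A x i))"
    unfolding vec_norm_def by (rule L2_set_le_sum) simp
  also have "\<dots> \<le> (\<Sum>i<n. \<Sum>j<n. norm (A i j) * vec_norm n x)"
  proof (rule sum_mono)
    fix i assume "i \<in> {..<n}"
    have "norm (mat_app n A x i) \<le> (\<Sum>j<n. norm (A i j (x j)))"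
      unfolding mat_app_def by (rule norm_sum)
    also have "\<dots> \<le> (\<Sum>j<n. norm (A i j) * vec_norm n x)"
    proof (rule sum_mono)
      fix j assume "j \<in> {..<n}"
      then have "norm (x j) \<le> vec_norm n x"
        unfolding vec_norm_def by (intro member_le_L2_set) auto
      then show "norm (A i j (x j)) \<le> norm (A i j) * vec_norm n x"
        by (intro order_trans[OF norm_blinfun] mult_left_mono) auto
    qed
    finally show "norm (mat_app n A x i) \<le> (\<Sum>j<n. norm (A i j) * vec_norm n x)" .
  qed
  finally show ?thesis by (simp add: sum_distrib_right)
qed

lemma mat_norm_alt: "mat_norm n A = (SUP x\<in>{x. vec_norm n x \<le> 1}. vec_norm n (mat_app n A x))"
  by (simp add: mat_norm_def vec_norm_def mat_app_def)

lemma mat_app_le_mat_norm_unit: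
  assumes "vec_norm n x \<le> 1"
  shows "vec_norm n (mat_app n A x) \<le> mat_norm n A"
  unfolding mat_norm_alt
proof (rule cSUP_upper)
  let ?C = "\<Sum>i<n. \<Sum>j<n. norm (A i j)"
  have "vec_norm n (mat_app n A x) \<le> ?C" if "vec_norm n x \<le> 1" for x
    using mat_app_bounded[of n A x] mult_left_mono[OF that, of ?C] by (simp add: sum_nonneg)
  then show "bdd_above ((\<lambda>x. vec_norm n (mat_app n A x)) ` {x. vec_norm n x \<le> 1})"
    by (intro bdd_aboveI[of _ ?C]) auto
qed (use assms in simp)

lemma mat_app_le_mat_norm: "vec_norm n (mat_app n A x) \<le> mat_norm n A * vec_norm n x"
proof (cases "vec_norm n x = 0")
  case True
  then show ?thesis using mat_app_bounded[of n A x] by simp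
next
  case False
  let ?c = "1 / vec_norm n x"
  have pos: "vec_norm n x > 0" using False vec_norm_nonneg[of n x] by linarith
  have "vec_norm n (mat_app n A (\<lambda>i. ?c *\<^sub>R x i)) \<le> mat_norm n A"
    by (rule mat_app_le_mat_norm_unit) (simp add: vec_norm_scaleR)
  moreover have "mat_app n A (\<lambda>i. ?c *\<^sub>R x i) = (\<lambda>i. ?c *\<^sub>R mat_app n A x i)"
    by (rule ext) (rule mat_app_scaleR)
  ultimately show ?thesis using pos by (simp add: vec_norm_scaleR field_simps)
qed

lemma mat_norm_nonneg: "0 \<le> mat_norm n A"
proof -
  have "vec_norm n (\<lambda>i. 0 :: 'a) \<le> 1" by (simp add: vec_norm_def L2_set_def)
  from mat_app_le_mat_norm_unit[OF this, of A] show ?thesis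
    using vec_norm_nonneg order_trans by blast
qed

lemma mat_norm_leI:
  fixes A :: "nat \<Rightarrow> nat \<Rightarrow> 'a::chilbert_space \<Rightarrow>\<^sub>L 'a"
  assumes "0 \<le> c" "\<And>x. vec_norm n (mat_app n A x) \<le> c * vec_norm n x"
  shows "mat_norm n A \<le> c"
  unfolding mat_norm_alt
proof (rule cSUP_least)
  have "vec_norm n (\<lambda>i. 0 :: 'a) \<le> 1" by (simp add: vec_norm_def L2_set_def)
  then show "{x :: nat \<Rightarrow> 'a. vec_norm n x \<le> 1} \<noteq> {}" by blast
next
  fix x :: "nat \<Rightarrow> 'a" assume "x \<in> {x. vec_norm n x \<le> 1}"
  then show "vec_norm n (mat_app n A x) \<le> c"
    using assms(2)[of x] mult_left_mono[OF _ assms(1), of "vec_norm n x" 1] by simp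
qed

lemma completely_contractiveD:
  assumes "completely_contractive S f" "\<And>i j. i < n \<Longrightarrow> j < n \<Longrightarrow> A i j \<in> S" "mat_norm n A \<le> 1"
  shows "mat_norm n (\<lambda>i j. f (A i j)) \<le> 1"
proof -
  have "ereal (mat_norm n (\<lambda>i j. f (A i j))) \<le> cb_norm S f"
    unfolding cb_norm_def
    by (rule SUP_upper2[of "(n, A)"]) (use assms in auto)
  also have "\<dots> \<le> 1" using assms(1) by (simp add: completely_contractive_def)
  finally show ?thesis by (simp add: one_ereal_def)
qed

lemma mat_app_contraction:
  assumes "completely_contractive S f" "\<And>i j. i < n \<Longrightarrow> j < n \<Longrightarrow> A i j \<in> S"
    and "\<And>x. vec_norm n (mat_app n A x) \<le> vec_norm n x"
  shows "vec_norm n (mat_app n (\<lambda>i j. f (A i j)) y) \<le> vec_norm n y"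
proof -
  have "mat_norm n (\<lambda>i j. f (A i j)) \<le> 1"
    by (rule completely_contractiveD[OF assms(1,2)]) (use assms(3) in \<open>auto intro: mat_norm_leI\<close>)
  then show ?thesis
    using mat_app_le_mat_norm[of n "\<lambda>i j. f (A i j)" y] mult_right_mono[of _ 1 "vec_norm n y"]
    by (smt (verit) vec_norm_nonneg)
qed

lemma vec_norm_1: "vec_norm 1 x = norm (x 0)"
  by (simp add: vec_norm_def L2_set_def)

lemma mat_app_1: "mat_app 1 A x 0 = A 0 0 (x 0)"
  by (simp add: mat_app_def)

text \<open>Apply the hypothesis to 1 x 1 matrices in the unit ball and rescale.\<close>

lemma completely_contractive_imp_contractive:
  assumes "completely_contractive S f" "clinear_into_ops S f" "complex_vector.subspace S"
  shows "contractive S f"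
  unfolding contractive_def
proof
  fix a assume a: "a \<in> S"
  have unit: "norm (f b) \<le> 1" if b: "b \<in> S" "norm b \<le> 1" for b
  proof (rule norm_blinfun_bound)
    fix x
    have "norm (b v) \<le> norm v" for v
      using norm_blinfun[of b v] mult_right_mono[OF b(2), of "norm v"] by simp
    then have "vec_norm 1 (mat_app 1 (\<lambda>i j. f b) (\<lambda>i. x)) \<le> vec_norm 1 (\<lambda>i. x)"
      by (intro mat_app_contraction[OF assms(1)]) (simp_all only: b(1) vec_norm_1 mat_app_1)
    then show "norm (f b x) \<le> 1 * norm x" by (simp only: vec_norm_1 mat_app_1 mult_1)
  qed simp
  show "norm (f a) \<le> norm a"
  proof (cases "norm a = 0")
    case True
    then have "f a = 0 *\<^sub>R f a"
      using clinear_into_opsD(4)[OF assms(2) a, of 0] by simp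
    then show ?thesis by simp
  next
    case False
    have "norm (f ((1 / norm a) *\<^sub>R a)) \<le> 1"
    proof (rule unit)
      show "(1 / norm a) *\<^sub>R a \<in> S"
        unfolding scaleR_scaleC by (rule complex_vector.subspace_scale[OF assms(3) a])
    qed (use False in simp)
    then show ?thesis
      using False clinear_into_opsD(4)[OF assms(2) a, of "1 / norm a"] by (simp add: field_simps)
  qed
qed

section \<open>Complete positivity\<close>

lemma vec_inner_single_right:
  assumes "i < n"
  shows "vec_inner n z (\<lambda>k. if k = i then w else 0) = inner (z i) w"
proof -
  have "vec_inner n z (\<lambda>k. if k = i then w else 0) = (\<Sum>k<n. if k = i then inner (z k) w else 0)"
    unfolding vec_inner_def by (rule sum.cong) auto
  then show ?thesis using assms by simp
qed

lemma mat_app_single: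
  assumes "j < n"
  shows "mat_app n A (\<lambda>k. if k = j then v else 0) i = A i j v"
proof -
  have "mat_app n A (\<lambda>k. if k = j then v else 0) i = (\<Sum>k<n. if k = j then A i k v else 0)"
    unfolding mat_app_def by (rule sum.cong) auto
  then show ?thesis using assms by simp
qed

lemma mat_app_add: "mat_app n A (\<lambda>i. x i + y i) i = mat_app n A x i + mat_app n A y i"
  by (simp add: mat_app_def blinfun.add_right sum.distrib)

lemma mat_app_scaleC:
  assumes "\<And>i j. i < n \<Longrightarrow> j < n \<Longrightarrow> A i j \<in> bounded_ops" "i < n"
  shows "mat_app n A (\<lambda>i. c *\<^sub>C x i) i = c *\<^sub>C mat_app n A x i"
  unfolding mat_app_def complex_vector.scale_sum_right
  by (rule sum.cong) (use assms in \<open>auto simp: bounded_opsD\<close>)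

lemma mat_positive_alt:
  "mat_positive n A \<longleftrightarrow>
    (\<forall>x. 0 \<le> vec_inner n (mat_app n A x) x \<and> vec_inner n (mat_app n A x) (\<lambda>i. \<i> *\<^sub>C x i) = 0)"
proof -
  have "(\<Sum>i<n. cinner (\<Sum>j<n. A i j (x j)) (x i)) \<in> \<real>\<^sub>\<ge>\<^sub>0 \<longleftrightarrow>
      0 \<le> vec_inner n (mat_app n A x) x \<and> vec_inner n (mat_app n A x) (\<lambda>i. \<i> *\<^sub>C x i) = 0" for x
    by (simp add: complex_nonneg_Reals_iff vec_inner_def mat_app_def cinner_eq_inner Re_sum Im_sum)
  then show ?thesis by (simp add: mat_positive_def)
qed

text \<open>A complex form with real values is Hermitian: polarize the vanishing imaginary part,
  then replace y by i y.\<close>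

lemma mat_positive_sym:
  fixes A :: "nat \<Rightarrow> nat \<Rightarrow> 'a::chilbert_space \<Rightarrow>\<^sub>L 'a"
  assumes A: "\<And>i j. i < n \<Longrightarrow> j < n \<Longrightarrow> A i j \<in> bounded_ops" and pos: "mat_positive n A"
  shows "vec_inner n (mat_app n A x) y = vec_inner n x (mat_app n A y)"
proof -
  let ?T = "mat_app n A" and ?im = "\<lambda>x (i::nat). \<i> *\<^sub>C (x i)"
  have 0: "vec_inner n (?T x) (?im x) = 0" for x
    using pos unfolding mat_positive_alt by blast
  have add_l: "vec_inner n (\<lambda>i. x i + y i) z = vec_inner n x z + vec_inner n y z"
    and add_r: "vec_inner n z (\<lambda>i. x i + y i) = vec_inner n z x + vec_inner n z y" for x y z
    by (simp_all add: vec_inner_def inner_add_left inner_add_right sum.distrib)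
  have polar: "vec_inner n (?T x) (?im y) + vec_inner n (?T y) (?im x) = 0" for x y
    using 0[of "\<lambda>i. x i + y i"] 0[of x] 0[of y]
    by (simp add: mat_app_add[abs_def] scaleC_add_right add_l add_r)
  have T_im: "vec_inner n (?T (?im y)) z = vec_inner n (?im (?T y)) z" for y z
    unfolding vec_inner_def by (rule sum.cong) (use mat_app_scaleC[OF A] in auto)
  have im_im: "vec_inner n (?im z) (?im x) = vec_inner n z x" for z x :: "nat \<Rightarrow> 'a"
    by (simp add: vec_inner_def inner_scaleC_left)
  have "vec_inner n (?T x) (?im (?im y)) = - vec_inner n (?T x) y"
    by (simp add: vec_inner_def sum_negf)
  moreover have "vec_inner n (?T (?im y)) (?im x) = vec_inner n (?T y) x"
    by (simp only: T_im im_im)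
  ultimately have "vec_inner n (?T x) y = vec_inner n (?T y) x"
    using polar[of x "?im y"] by simp
  then show ?thesis by (simp only: vec_inner_commute)
qed

text \<open>Test the symmetry on vectors with a single nonzero entry. In this entrywise form,
  self-adjointness of a matrix can be carried through a *-homomorphism.\<close>

lemma mat_positive_adj:
  fixes A :: "nat \<Rightarrow> nat \<Rightarrow> 'a::chilbert_space \<Rightarrow>\<^sub>L 'a"
  assumes A: "\<And>i j. i < n \<Longrightarrow> j < n \<Longrightarrow> A i j \<in> bounded_ops" and pos: "mat_positive n A"
    and ij: "i < n" "j < n"
  shows "adj (A i j) = A j i"
proof (rule adj_eqI[OF A[OF ij]])
  fix v w :: 'a
  let ?x = "\<lambda>k. if k = j then v else 0" and ?y = "\<lambda>k. if k = i then w else 0"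
  have "inner (A i j v) w = vec_inner n (mat_app n A ?x) ?y"
    using ij by (simp add: vec_inner_single_right mat_app_single)
  also have "\<dots> = vec_inner n (mat_app n A ?y) ?x"
    using mat_positive_sym[OF A pos] by (simp only: vec_inner_commute)
  also have "\<dots> = inner v (A j i w)"
    using ij by (simp add: vec_inner_single_right mat_app_single inner_commute)
  finally show "inner (A i j v) w = inner v (A j i w)" .
qed

lemma mat_app_sym:
  assumes A: "\<And>i j. i < n \<Longrightarrow> j < n \<Longrightarrow> A i j \<in> bounded_ops"
    and adj: "\<And>i j. i < n \<Longrightarrow> j < n \<Longrightarrow> adj (A i j) = A j i"
  shows "vec_inner n (mat_app n A x) y = vec_inner n x (mat_app n A y)"
proof -
  have "vec_inner n (mat_app n A x) y = (\<Sum>i<n. \<Sum>j<n. inner (A i j (x j)) (y i))"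
    by (simp add: vec_inner_def mat_app_def inner_sum_left)
  also have "\<dots> = (\<Sum>i<n. \<Sum>j<n. inner (x j) (A j i (y i)))"
    by (intro sum.cong refl) (use A adj in \<open>auto simp: inner_adj\<close>)
  also have "\<dots> = (\<Sum>j<n. \<Sum>i<n. inner (x j) (A j i (y i)))"
    by (rule sum.swap)
  also have "\<dots> = vec_inner n x (mat_app n A y)"
    by (simp add: vec_inner_def mat_app_def inner_sum_right)
  finally show ?thesis .
qed

text \<open>The entries of the matrix $A(1 - A)^k$.\<close>

primrec mat_damp :: "nat \<Rightarrow> (nat \<Rightarrow> nat \<Rightarrow> 'a::real_normed_vector \<Rightarrow>\<^sub>L 'a) \<Rightarrow> nat \<Rightarrow> nat \<Rightarrow> nat \<Rightarrow> 'a \<Rightarrow>\<^sub>L 'a" where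
  "mat_damp n A 0 = A"
| "mat_damp n A (Suc k) = (\<lambda>i j. mat_damp n A k i j - (\<Sum>l<n. A i l o\<^sub>L mat_damp n A k l j))"

lemma mat_app_damp_Suc:
  "mat_app n (mat_damp n A (Suc k)) x i =
    mat_app n (mat_damp n A k) x i - mat_app n A (mat_app n (mat_damp n A k) x) i"
proof -
  have "mat_app n A (mat_app n (mat_damp n A k) x) i = (\<Sum>l<n. \<Sum>j<n. A i l (mat_damp n A k l j (x j)))"
    by (simp add: mat_app_def blinfun.sum_right)
  also have "\<dots> = (\<Sum>j<n. \<Sum>l<n. A i l (mat_damp n A k l j (x j)))"
    by (rule sum.swap)
  finally show ?thesis
    by (simp add: mat_app_def blinfun.diff_left blinfun.sum_left sum_subtractf)
qed

text \<open>For 0 <= T <= 1 one has T^2 <= T, hence |y - T y| <= |y|, so 1 - T is a contraction as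
  well as T. This is the direct half of the positivity test;
  \<open>form_nonneg_if_damp_bounded\<close> is the converse half.\<close>

lemma mat_damp_contraction:
  assumes sym: "\<And>x y. vec_inner n (mat_app n A x) y = vec_inner n x (mat_app n A y)"
    and pos: "\<And>x. 0 \<le> vec_inner n (mat_app n A x) x"
    and contr: "\<And>x. vec_norm n (mat_app n A x) \<le> vec_norm n x"
  shows "vec_norm n (mat_app n (mat_damp n A k) x) \<le> vec_norm n x"
proof (induction k)
  case 0
  then show ?case by (simp add: contr)
next
  case (Suc k)
  let ?T = "mat_app n A"
  have form_le: "vec_inner n (?T y) y \<le> (vec_norm n y)\<^sup>2" for y
  proof -
    have "vec_inner n (?T y) y \<le> vec_norm n (?T y) * vec_norm n y"
      using vec_inner_le[of n "?T y" y] by linarith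
    also have "\<dots> \<le> vec_norm n y * vec_norm n y"
      by (intro mult_right_mono contr) simp
    finally show ?thesis by (simp add: power2_eq_square)
  qed
  have sq_le: "(vec_norm n (?T y))\<^sup>2 \<le> vec_inner n (?T y) y" for y
  proof -
    have "0 \<le> vec_inner n (?T (\<lambda>i. y i - ?T y i)) (\<lambda>i. y i - ?T y i)" by (rule pos)
    also have "\<dots> = vec_inner n (?T y) y - 2 * (vec_norm n (?T y))\<^sup>2 + vec_inner n (?T (?T y)) (?T y)"
      by (simp add: mat_app_diff[abs_def] vec_inner_diff_left vec_inner_diff_right vec_norm_sq sym[of "?T y" y])
    finally show ?thesis using form_le[of "?T y"] by simp
  qed
  have "vec_norm n (\<lambda>i. y i - ?T y i) \<le> vec_norm n y" for y
  proof (rule power2_le_imp_le)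
    have "(vec_norm n (\<lambda>i. y i - ?T y i))\<^sup>2
        = (vec_norm n y)\<^sup>2 - 2 * vec_inner n (?T y) y + (vec_norm n (?T y))\<^sup>2"
      by (simp add: vec_norm_sq vec_inner_diff_left vec_inner_diff_right vec_inner_commute)
    then show "(vec_norm n (\<lambda>i. y i - ?T y i))\<^sup>2 \<le> (vec_norm n y)\<^sup>2"
      using sq_le[of y] pos[of y] by linarith
  qed simp
  then have "vec_norm n (mat_app n (mat_damp n A (Suc k)) x) \<le> vec_norm n (mat_app n (mat_damp n A k) x)"
    by (simp only: mat_app_damp_Suc[abs_def])
  then show ?case using Suc.IH by simp
qed

text \<open>If \<open>B\<close> had a negative vector \<open>x\<close>, the values of the form at $(1 - B)^k x$ would decrease by at
  least a fixed amount in every step, contradicting boundedness of $B(1 - B)^k$.\<close>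

lemma form_nonneg_if_damp_bounded:
  fixes B :: "nat \<Rightarrow> nat \<Rightarrow> 'a::real_inner \<Rightarrow>\<^sub>L 'a"
  assumes sym: "\<And>x y. vec_inner n (mat_app n B x) y = vec_inner n x (mat_app n B y)"
    and damp: "\<And>k x. vec_norm n (mat_app n (mat_damp n B k) x) \<le> vec_norm n x"
  shows "0 \<le> vec_inner n (mat_app n B x) x"
proof (rule ccontr)
  assume neg: "\<not> 0 \<le> vec_inner n (mat_app n B x) x"
  let ?T = "mat_app n B"
  \<comment> \<open>\<open>u k\<close> is (1 - B)^k x.\<close>
  define u where "u = rec_nat x (\<lambda>_ v i. v i - ?T v i)"
  have u0: "u 0 = x" and uS: "u (Suc k) = (\<lambda>i. u k i - ?T (u k) i)" for k
    by (simp_all add: u_def)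
  have Tu: "?T (u k) = mat_app n (mat_damp n B k) x" for k
  proof (induction k)
    case (Suc k)
    have "?T (u (Suc k)) = (\<lambda>i. ?T (u k) i - ?T (?T (u k)) i)"
      by (simp add: uS mat_app_diff[abs_def])
    also have "\<dots> = mat_app n (mat_damp n B (Suc k)) x"
      by (rule ext) (simp only: Suc.IH mat_app_damp_Suc)
    finally show ?case .
  qed (simp add: u0)
  have Tu_le: "vec_norm n (?T (u k)) \<le> vec_norm n x" for k
    unfolding Tu by (rule damp)
  define g where "g k = vec_inner n (?T (u k)) (u k)" for k
  have contr: "vec_norm n (?T v) \<le> vec_norm n v" for v
    using damp[of 0 v] by simp
  have g_Suc: "g (Suc k) \<le> g k - (vec_norm n (?T (u k)))\<^sup>2" for k
  proof -
    let ?v = "u k"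
    have "g (Suc k) = g k - 2 * (vec_norm n (?T ?v))\<^sup>2 + vec_inner n (?T (?T ?v)) (?T ?v)"
      by (simp add: g_def uS mat_app_diff[abs_def] vec_inner_diff_left vec_inner_diff_right vec_norm_sq
          sym[of "?T ?v" ?v])
    moreover have "vec_inner n (?T (?T ?v)) (?T ?v) \<le> (vec_norm n (?T ?v))\<^sup>2"
    proof -
      have "vec_inner n (?T (?T ?v)) (?T ?v) \<le> vec_norm n (?T (?T ?v)) * vec_norm n (?T ?v)"
        using vec_inner_le[of n "?T (?T ?v)" "?T ?v"] by linarith
      also have "\<dots> \<le> vec_norm n (?T ?v) * vec_norm n (?T ?v)"
        by (intro mult_right_mono contr) simp
      finally show ?thesis by (simp add: power2_eq_square)
    qed
    ultimately show ?thesis by simp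
  qed
  have g_le: "g k \<le> g 0" for k
    by (induction k) (use g_Suc zero_le_power2 in \<open>smt (verit)\<close>)+
  \<comment> \<open>Symmetry moves the k factors 1 - B from the right argument to the left. The form
    becomes a pairing of B(1 - B)^(2k) x with the fixed vector x, which \<open>damp\<close>
    controls.\<close>
  have g_shift: "g k = vec_inner n (?T (u (k + k))) x" for k
  proof -
    have "vec_inner n (?T (u (k + m))) (u l) = vec_inner n (?T (u m)) (u (k + l))" for m l
    proof (induction k arbitrary: m l)
      case (Suc k)
      have "vec_inner n (?T (u (Suc p))) (u q) = vec_inner n (?T (u p)) (u (Suc q))" for p q
        by (simp add: uS mat_app_diff[abs_def] vec_inner_diff_left vec_inner_diff_right sym)
      from this[of "k + m" l] this[of m "k + l"] show ?case
        using Suc.IH[of m "Suc l"] by simp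
    qed simp
    from this[of k 0] show ?thesis by (simp add: g_def u0)
  qed
  define \<delta> where "\<delta> = - g 0"
  have \<delta>: "\<delta> > 0" using neg by (simp add: \<delta>_def g_def u0)
  \<comment> \<open>Only even indices are reached by \<open>g_shift\<close>, so \<open>decay\<close>
    below gains \<eta> once in two steps.\<close>
  have lower: "\<delta> \<le> vec_norm n (?T (u k)) * vec_norm n x" if "even k" for k
  proof -
    from that obtain m where "k = m + m" by (metis evenE mult_2)
    then show ?thesis
      using g_le[of m] g_shift[of m] vec_inner_le[of n "?T (u k)" x] by (simp add: \<delta>_def)
  qed
  have nx: "vec_norm n x > 0"
    using lower[of 0] \<delta> by (simp add: less_le) auto
  \<comment> \<open>The square of the lower bound for |B u_k| contained in
    \<open>lower\<close>.\<close>
  define \<eta> where "\<eta> = (\<delta> / vec_norm n x)\<^sup>2"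
  have \<eta>: "\<eta> > 0" using \<delta> nx by (simp add: \<eta>_def)
  have decay: "g (2 * k) \<le> g 0 - real k * \<eta>" for k
  proof (induction k)
    case (Suc k)
    have "\<delta> / vec_norm n x \<le> vec_norm n (?T (u (2 * k)))"
      using lower[of "2 * k"] nx by (simp add: field_simps)
    then have "\<eta> \<le> (vec_norm n (?T (u (2 * k))))\<^sup>2"
      unfolding \<eta>_def using \<delta> nx by (intro power_mono) auto
    then have "g (Suc (2 * k)) \<le> g (2 * k) - \<eta>" using g_Suc[of "2 * k"] by linarith
    moreover have "g (Suc (Suc (2 * k))) \<le> g (Suc (2 * k))"
      using g_Suc[of "Suc (2 * k)"] by (smt (verit) zero_le_power2)
    ultimately have "g (2 * Suc k) \<le> g (2 * k) - \<eta>" by simp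
    then show ?case using Suc.IH by (simp add: algebra_simps)
  qed simp
  have g_ge: "- (vec_norm n x)\<^sup>2 \<le> g k" for k
  proof -
    have "\<bar>g k\<bar> \<le> vec_norm n (?T (u (k + k))) * vec_norm n x"
      unfolding g_shift by (rule vec_inner_le)
    also have "\<dots> \<le> vec_norm n x * vec_norm n x"
      by (intro mult_right_mono Tu_le) simp
    finally show ?thesis by (simp add: power2_eq_square)
  qed
  obtain k where "(vec_norm n x)\<^sup>2 / \<eta> < real k" using reals_Archimedean2 by blast
  then have "(vec_norm n x)\<^sup>2 < real k * \<eta>" using \<eta> by (simp add: field_simps)
  then show False using decay[of k] g_ge[of "2 * k"] \<delta> by (simp add: \<delta>_def)
qed

text \<open>The entries commute with multiplication by i, so symmetry makes the imaginary part of
  the form equal to its own negative.\<close>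

lemma mat_positiveI:
  fixes A :: "nat \<Rightarrow> nat \<Rightarrow> 'a::chilbert_space \<Rightarrow>\<^sub>L 'a"
  assumes A: "\<And>i j. i < n \<Longrightarrow> j < n \<Longrightarrow> A i j \<in> bounded_ops"
    and sym: "\<And>x y. vec_inner n (mat_app n A x) y = vec_inner n x (mat_app n A y)"
    and pos: "\<And>x. 0 \<le> vec_inner n (mat_app n A x) x"
  shows "mat_positive n A"
  unfolding mat_positive_alt
proof (intro allI conjI pos)
  fix x :: "nat \<Rightarrow> 'a"
  let ?T = "mat_app n A"
  have "vec_inner n (?T x) (\<lambda>i. \<i> *\<^sub>C x i) = vec_inner n x (?T (\<lambda>i. \<i> *\<^sub>C x i))"
    by (rule sym)
  also have "\<dots> = vec_inner n x (\<lambda>i. \<i> *\<^sub>C ?T x i)"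
    unfolding vec_inner_def by (rule sum.cong) (use mat_app_scaleC[OF A] in auto)
  also have "\<dots> = - vec_inner n (\<lambda>i. \<i> *\<^sub>C x i) (?T x)"
    by (simp add: vec_inner_def sum_negf[symmetric] inner_scaleC_left)
  also have "\<dots> = - vec_inner n (?T x) (\<lambda>i. \<i> *\<^sub>C x i)"
    by (simp only: vec_inner_commute)
  finally show "vec_inner n (?T x) (\<lambda>i. \<i> *\<^sub>C x i) = 0" by simp
qed

lemma vec_norm_cong: "(\<And>i. i < n \<Longrightarrow> x i = y i) \<Longrightarrow> vec_norm n x = vec_norm n y"
  unfolding vec_norm_def by (rule L2_set_cong) auto

lemma mat_app_cong: "(\<And>j. j < n \<Longrightarrow> A i j = B i j) \<Longrightarrow> mat_app n A x i = mat_app n B x i"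
  unfolding mat_app_def by (rule sum.cong) auto

lemma clinear_into_ops_sum:
  assumes "clinear_into_ops S f" "complex_vector.subspace S" "finite I" "\<And>i. i \<in> I \<Longrightarrow> a i \<in> S"
  shows "f (\<Sum>i\<in>I. a i) = (\<Sum>i\<in>I. f (a i))"
  using assms(3,4)
proof (induction I rule: finite_induct)
  case empty
  have "f (0 *\<^sub>C 0) = 0 *\<^sub>C f 0"
    by (rule clinear_into_opsD(3)[OF assms(1)]) (rule complex_vector.subspace_0[OF assms(2)])
  then show ?case by simp
next
  case (insert i I)
  then show ?case
    by (simp add: clinear_into_opsD(2)[OF assms(1)] complex_vector.subspace_sum[OF assms(2)])
qed

lemma mat_damp_mem:
  assumes A: "cstar_subalgebra A" and B: "\<And>i j. i < n \<Longrightarrow> j < n \<Longrightarrow> B i j \<in> A"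
    and ij: "i < n" "j < n"
  shows "mat_damp n B k i j \<in> A"
  using ij
proof (induction k arbitrary: i j)
  case (Suc k)
  have "(\<Sum>l<n. B i l o\<^sub>L mat_damp n B k l j) \<in> A"
    by (rule complex_vector.subspace_sum[OF subspace_cstar_subalgebra[OF A]])
      (use Suc B cstar_subalgebraD(7)[OF A] in auto)
  then show ?case using Suc cstar_subalgebraD(4)[OF A] by simp
qed (simp add: B)

text \<open>The polynomial B(1 - B)^k has no constant term, so its entries are sums and differences
  of products of entries of B, and a homomorphism without unit passes through them.\<close>

lemma op_hom_mat_damp:
  assumes A: "cstar_subalgebra A" and f: "op_hom A f"
    and B: "\<And>i j. i < n \<Longrightarrow> j < n \<Longrightarrow> B i j \<in> A" and ij: "i < n" "j < n"
  shows "f (mat_damp n B k i j) = mat_damp n (\<lambda>i j. f (B i j)) k i j"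
  using ij
proof (induction k arbitrary: i j)
  case (Suc k)
  note lin = op_homD(1)[OF f] and sub = subspace_cstar_subalgebra[OF A]
  note mem = mat_damp_mem[OF A B]
  have prod: "B i l o\<^sub>L mat_damp n B k l j \<in> A" if "l < n" for l
    using that Suc.prems B mem cstar_subalgebraD(7)[OF A] by auto
  have sum: "(\<Sum>l<n. B i l o\<^sub>L mat_damp n B k l j) \<in> A"
    by (rule complex_vector.subspace_sum[OF sub]) (use prod in auto)
  have "f (mat_damp n B (Suc k) i j) = f (mat_damp n B k i j) - f (\<Sum>l<n. B i l o\<^sub>L mat_damp n B k l j)"
    unfolding mat_damp.simps
    by (rule clinear_into_ops_diff[OF lin sub mem]) (use Suc.prems sum in auto)
  also have "f (\<Sum>l<n. B i l o\<^sub>L mat_damp n B k l j) = (\<Sum>l<n. f (B i l o\<^sub>L mat_damp n B k l j))"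
    by (rule clinear_into_ops_sum[OF lin sub]) (use prod in auto)
  also have "\<dots> = (\<Sum>l<n. f (B i l) o\<^sub>L mat_damp n (\<lambda>i j. f (B i j)) k l j)"
    by (rule sum.cong) (use Suc B mem op_homD(2)[OF f] in auto)
  finally show ?case using Suc by simp
qed simp

text \<open>Positivity of B, after scaling, bounds all B(1 - B)^k; complete contractivity transfers
  the bounds to the image matrix, and \<open>form_nonneg_if_damp_bounded\<close> turns them back
  into positivity. Preservation of adjoints supplies the symmetry.\<close>

lemma star_hom_completely_positive:
  fixes A :: "('a::chilbert_space \<Rightarrow>\<^sub>L 'a) set"
    and f :: "('a \<Rightarrow>\<^sub>L 'a) \<Rightarrow> ('b::chilbert_space \<Rightarrow>\<^sub>L 'b)"
  assumes A: "cstar_subalgebra A" and f: "star_hom A f" and cc: "completely_contractive A f"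
  shows "completely_positive A f"
  unfolding completely_positive_def
proof (intro allI impI, elim conjE)
  fix n and B :: "nat \<Rightarrow> nat \<Rightarrow> 'a \<Rightarrow>\<^sub>L 'a"
  assume "\<forall>i<n. \<forall>j<n. B i j \<in> A" and pos: "mat_positive n B"
  then have B: "\<And>i j. i < n \<Longrightarrow> j < n \<Longrightarrow> B i j \<in> A" by blast
  have hom: "op_hom A f" and star: "\<And>a. a \<in> A \<Longrightarrow> f (adj a) = adj (f a)"
    using f by (auto simp: star_hom_def)
  note lin = op_homD(1)[OF hom]
  have Bops: "\<And>i j. i < n \<Longrightarrow> j < n \<Longrightarrow> B i j \<in> bounded_ops"
    using B cstar_subalgebraD(1)[OF A] by blast
  have fBops: "\<And>i j. i < n \<Longrightarrow> j < n \<Longrightarrow> f (B i j) \<in> bounded_ops"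
    using clinear_into_opsD(1)[OF lin] B by blast
  have fBsym: "vec_inner n (mat_app n (\<lambda>i j. f (B i j)) x) y = vec_inner n x (mat_app n (\<lambda>i j. f (B i j)) y)" for x y
    by (rule mat_app_sym[OF fBops]) (use star B mat_positive_adj[OF Bops pos] in metis)+
  show "mat_positive n (\<lambda>i j. f (B i j))"
  proof (rule mat_positiveI[OF fBops fBsym])
    fix x :: "nat \<Rightarrow> 'b"
    \<comment> \<open>Scales \<open>B\<close> to a contraction; the 1 in the denominator covers norm
      0.\<close>
    define s where "s = 1 / (mat_norm n B + 1)"
    have s: "s > 0" using mat_norm_nonneg[of n B] by (simp add: s_def)
    define C where "C i j = s *\<^sub>R B i j" for i j
    have C: "\<And>i j. i < n \<Longrightarrow> j < n \<Longrightarrow> C i j \<in> A"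
      using B cstar_subalgebraD(6)[OF A] by (simp add: C_def)
    have CB: "mat_app n C y i = s *\<^sub>R mat_app n B y i" for y i
      by (simp add: mat_app_def C_def blinfun.scaleR_left scaleR_sum_right)
    have scale: "vec_inner n (\<lambda>i. s *\<^sub>R y i) z = s * vec_inner n y z"
      "vec_inner n z (\<lambda>i. s *\<^sub>R y i) = s * vec_inner n z y" for y z :: "nat \<Rightarrow> 'c::real_inner"
      by (simp_all add: vec_inner_def sum_distrib_left)
    have C_contr: "vec_norm n (mat_app n C y) \<le> vec_norm n y" for y
    proof -
      have "vec_norm n (mat_app n C y) = s * vec_norm n (mat_app n B y)"
        using s by (simp add: CB[abs_def] vec_norm_scaleR)
      also have "\<dots> \<le> s * (mat_norm n B * vec_norm n y)"
        using s by (intro mult_left_mono mat_app_le_mat_norm) simp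
      also have "\<dots> = (s * mat_norm n B) * vec_norm n y" by simp
      also have "\<dots> \<le> 1 * vec_norm n y"
        using mat_norm_nonneg[of n B] by (intro mult_right_mono) (simp_all add: s_def)
      finally show ?thesis by simp
    qed
    have C_damp: "vec_norm n (mat_app n (mat_damp n C k) y) \<le> vec_norm n y" for k y
    proof (rule mat_damp_contraction[OF _ _ C_contr])
      show "vec_inner n (mat_app n C x) y = vec_inner n x (mat_app n C y)" for x y
        using mat_positive_sym[OF Bops pos] by (simp add: CB[abs_def] scale)
      show "0 \<le> vec_inner n (mat_app n C x) x" for x
        using pos s by (simp add: CB[abs_def] scale mat_positive_alt)
    qed
    let ?fC = "\<lambda>i j. f (C i j)"
    have fCB: "mat_app n ?fC y i = s *\<^sub>R mat_app n (\<lambda>i j. f (B i j)) y i" if "i < n" for y i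
    proof -
      have "mat_app n ?fC y i = mat_app n (\<lambda>i j. s *\<^sub>R f (B i j)) y i"
        by (rule mat_app_cong) (use that B clinear_into_opsD(4)[OF lin] in \<open>simp add: C_def\<close>)
      then show ?thesis by (simp add: mat_app_def blinfun.scaleR_left scaleR_sum_right)
    qed
    have fC_inner: "vec_inner n (mat_app n ?fC y) z = s * vec_inner n (mat_app n (\<lambda>i j. f (B i j)) y) z" for y z
      unfolding scale(1)[symmetric] unfolding vec_inner_def by (rule sum.cong) (use fCB in auto)
    have "0 \<le> vec_inner n (mat_app n ?fC x) x"
    proof (rule form_nonneg_if_damp_bounded)
      show "vec_inner n (mat_app n ?fC x) y = vec_inner n x (mat_app n ?fC y)" for x y
        using fBsym[of x y] fC_inner[of x y] fC_inner[of y x] by (simp add: vec_inner_commute)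
      show "vec_norm n (mat_app n (mat_damp n ?fC k) y) \<le> vec_norm n y" for k y
      proof -
        have "vec_norm n (mat_app n (mat_damp n ?fC k) y)
            = vec_norm n (mat_app n (\<lambda>i j. f (mat_damp n C k i j)) y)"
          by (intro vec_norm_cong mat_app_cong) (simp add: op_hom_mat_damp[OF A hom C])
        also have "\<dots> \<le> vec_norm n y"
          by (rule mat_app_contraction[OF cc mat_damp_mem[OF A C] C_damp])
        finally show ?thesis .
      qed
    qed
    then show "0 \<le> vec_inner n (mat_app n (\<lambda>i j. f (B i j)) x) x"
      using s by (simp add: fC_inner zero_le_mult_iff)
  qed
qed

lemma cinner_adj:
  assumes "T \<in> bounded_ops"
  shows "cinner (adj T y) x = cinner y (T x)"
proof -
  have "cinner (adj T y) x = cnj (cinner x (adj T y))" by (rule cinner_commute)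
  also have "\<dots> = cnj (cinner (T x) y)"
    by (simp only: cinner_adjointI[OF assms inner_adj[OF assms]])
  also have "\<dots> = cinner y (T x)" by (rule cinner_commute[symmetric])
  finally show ?thesis .
qed

lemma cinner_sum_left: "cinner (\<Sum>i\<in>I. x i) y = (\<Sum>i\<in>I. cinner (x i) y)"
proof -
  have "cinner (0 *\<^sub>C y) y = 0" by (subst cinner_scaleC_left) simp
  then show ?thesis
    by (induction I rule: infinite_finite_induct) (simp_all add: cinner_add_left)
qed

text \<open>The form of the conjugated matrix at the vectors x_j is the form of the original image
  matrix at the vectors W x_j.\<close>

lemma completely_positive_conjugate:
  assumes f: "completely_positive S f" and W: "W \<in> bounded_ops"
  shows "completely_positive S (\<lambda>a. adj W o\<^sub>L f a o\<^sub>L W)"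
  unfolding completely_positive_def
proof (intro allI impI)
  fix n A assume "(\<forall>i<n. \<forall>j<n. A i j \<in> S) \<and> mat_positive n A"
  then have "mat_positive n (\<lambda>i j. f (A i j))"
    using f by (auto simp: completely_positive_def)
  then have "(\<Sum>i<n. cinner (\<Sum>j<n. f (A i j) (W (x j))) (W (x i))) \<in> \<real>\<^sub>\<ge>\<^sub>0" for x
    unfolding mat_positive_def by (rule allE[of _ "\<lambda>j. W (x j)"])
  then show "mat_positive n (\<lambda>i j. adj W o\<^sub>L f (A i j) o\<^sub>L W)"
    by (simp add: mat_positive_def cinner_sum_left cinner_adj[OF W])
qed

section \<open>Similarities of bounded norm\<close>

lemma norm_sq_le_form_scaled:
  fixes T :: "'a::real_inner \<Rightarrow>\<^sub>L 'a"
  assumes sym: "\<And>x y. inner (T x) y = inner x (T y)" and "0 \<le> c"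
    and pos: "\<And>x. inner (T x) x \<ge> 0" and le: "\<And>x. inner (T x) x \<le> c * (norm x)\<^sup>2"
  shows "(norm (T x))\<^sup>2 \<le> c * inner (T x) x"
proof (cases "c = 0")
  \<comment> \<open>This occurs for r = 1 in \<open>similarity_norm_sq_le\<close>, where the factor
    r - 1/r vanishes.\<close>
  case True
  then have "inner (T y) y \<le> (norm y)\<^sup>2" for y
    using le[of y] by (simp add: order_trans[OF _ zero_le_power2])
  then have "(norm (T x))\<^sup>2 \<le> inner (T x) x"
    by (intro norm_sq_le_form[OF sym pos])
  then show ?thesis using le[of x] unfolding True by linarith
next
  case False
  let ?T = "(1 / c) *\<^sub>R T"
  have c: "c > 0" using False \<open>0 \<le> c\<close> by simp
  have "(norm (?T x))\<^sup>2 \<le> inner (?T x) x"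
  proof (rule norm_sq_le_form)
    show "inner (?T y) y \<le> (norm y)\<^sup>2" for y
      using le[of y] c by (simp add: blinfun.scaleR_left field_simps)
  qed (use sym pos c in \<open>simp_all add: blinfun.scaleR_left\<close>)
  then show ?thesis
    using mult_left_mono[of _ _ "c\<^sup>2"] c
    by (fastforce simp: blinfun.scaleR_left power_mult_distrib power_divide power2_eq_square[of c])
qed

lemma mutually_inverse_apply:
  assumes "mutually_inverse X Y"
  shows "X (Y x) = x" "Y (X x) = x"
  using assms unfolding mutually_inverse_def
  by (metis blinfun_apply_blinfun_compose id_blinfun.rep_eq id_apply)+

text \<open>With $S = X X^*$ the claim is $\|S v\|^2 + \|v\|^2 \le (r + 1/r) \langle S v, v\rangle$ for
  $v = (X^{-1})^* y$, which holds since the spectrum of $S$ lies in $[1/r, r]$.\<close>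

lemma similarity_norm_sq_le:
  assumes inv: "mutually_inverse X Y" and r: "r \<ge> 1"
    and nX: "norm X \<le> sqrt r" and nY: "norm Y \<le> sqrt r"
  shows "(norm (X y))\<^sup>2 + (norm (adj Y y))\<^sup>2 \<le> (r + 1 / r) * (norm y)\<^sup>2"
proof -
  have Xo: "X \<in> bounded_ops" and Yo: "Y \<in> bounded_ops"
    using inv by (auto simp: mutually_inverse_def)
  note XY = mutually_inverse_apply[OF inv]
  let ?S = "X o\<^sub>L adj X"
  \<comment> \<open>Shifted so that 0 <= T <= r - 1/r. Then T^2 <= (r - 1/r) T unfolds to (S -
    1/r)(S - r) <= 0, which is the inequality wanted.\<close>
  let ?T = "?S - (1 / r) *\<^sub>R id_blinfun"
  have adj_inv: "adj X (adj Y v) = v" "adj Y (adj X v) = v" for v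
    by (rule inner_right_ext, simp add: inner_adj[OF Xo, symmetric] inner_adj[OF Yo, symmetric] XY)+
  have Sform: "inner (X (adj X v)) v = (norm (adj X v))\<^sup>2" for v
    by (simp add: inner_adj[OF Xo] power2_norm_eq_inner)
  have Tv: "?T v = X (adj X v) - (1 / r) *\<^sub>R v" for v
    by (simp add: blinfun.diff_left blinfun.scaleR_left)
  have Tform: "inner (?T v) v = (norm (adj X v))\<^sup>2 - (1 / r) * (norm v)\<^sup>2" for v
    unfolding Tv inner_diff_left Sform by (simp add: power2_norm_eq_inner)
  have bound: "(norm (T v))\<^sup>2 \<le> r * (norm v)\<^sup>2" if "norm T \<le> sqrt r" for T :: "'a \<Rightarrow>\<^sub>L 'a" and v
  proof -
    have "norm (T v) \<le> sqrt r * norm v"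
      using norm_blinfun[of T v] mult_right_mono[OF that, of "norm v"] by simp
    then have "(norm (T v))\<^sup>2 \<le> (sqrt r * norm v)\<^sup>2" by (simp add: power_mono)
    then show ?thesis using r by (simp add: power_mult_distrib)
  qed
  have upper: "(norm (adj X v))\<^sup>2 \<le> r * (norm v)\<^sup>2" for v
    by (rule bound) (use norm_adj_le[OF Xo] nX in linarith)
  \<comment> \<open>The left-hand side is |v|^2, so the bound on the inverse becomes a lower bound
    for the adjoint of \<open>X\<close>.\<close>
  have "(norm (adj Y (adj X v)))\<^sup>2 \<le> r * (norm (adj X v))\<^sup>2" for v
    by (rule bound) (use norm_adj_le[OF Yo] nY in linarith)
  then have lower: "(1 / r) * (norm v)\<^sup>2 \<le> (norm (adj X v))\<^sup>2" for v
    using r by (simp add: adj_inv field_simps)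
  have "1 / r \<le> 1" using r by simp
  then have rr: "1 / r \<le> r" using r by linarith
  define v where "v = adj Y y"
  have yv: "y = adj X v" by (simp add: v_def adj_inv)
  have "(norm (?T v))\<^sup>2 \<le> (r - 1 / r) * inner (?T v) v"
  proof (rule norm_sq_le_form_scaled)
    show "inner (?T x) z = inner x (?T z)" for x z
      unfolding Tv inner_diff_left inner_diff_right
      by (simp add: inner_adj[OF Xo]) (simp add: inner_adj'[OF Xo])
    show "0 \<le> r - 1 / r" using rr by simp
    show "0 \<le> inner (?T x) x" for x unfolding Tform using lower[of x] by simp
    show "inner (?T x) x \<le> (r - 1 / r) * (norm x)\<^sup>2" for x
      unfolding Tform using upper[of x] by (simp add: left_diff_distrib)
  qed
  moreover have "(norm (?T v))\<^sup>2 = (norm (X y))\<^sup>2 - 2 * (1 / r) * (norm y)\<^sup>2 + (1 / r)\<^sup>2 * (norm v)\<^sup>2"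
  proof -
    have "inner (X y) v = (norm y)\<^sup>2" using Sform[of v] by (simp only: yv)
    then show ?thesis
      unfolding Tv yv[symmetric] power2_norm_eq_inner
      by (simp add: inner_diff_left inner_diff_right inner_commute power2_eq_square)
  qed
  moreover have "(r - 1 / r) * inner (?T v) v = (r - 1 / r) * (norm y)\<^sup>2 - (1 - (1 / r)\<^sup>2) * (norm v)\<^sup>2"
  proof -
    have "(r - 1 / r) * (1 / r) = 1 - (1 / r)\<^sup>2"
      using r by (simp add: diff_divide_distrib power2_eq_square)
    then show ?thesis
      unfolding Tform yv[symmetric] right_diff_distrib mult.assoc[symmetric] by simp
  qed
  ultimately show ?thesis by (simp add: algebra_simps v_def)
qed

text \<open>The cross term <X y, Y^* y> equals |y|^2 because Y X = 1.\<close>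

lemma similarity_combination_norm_sq:
  assumes inv: "mutually_inverse X Y"
  shows "(norm (X y + adj Y y))\<^sup>2 = (norm (X y))\<^sup>2 + (norm (adj Y y))\<^sup>2 + 2 * (norm y)\<^sup>2"
    and "(norm (X y - adj Y y))\<^sup>2 = (norm (X y))\<^sup>2 + (norm (adj Y y))\<^sup>2 - 2 * (norm y)\<^sup>2"
proof -
  have Yo: "Y \<in> bounded_ops" using inv by (auto simp: mutually_inverse_def)
  have "inner (X y) (adj Y y) = (norm y)\<^sup>2"
    by (simp add: inner_adj[OF Yo, symmetric] mutually_inverse_apply[OF inv] power2_norm_eq_inner)
  then show "(norm (X y + adj Y y))\<^sup>2 = (norm (X y))\<^sup>2 + (norm (adj Y y))\<^sup>2 + 2 * (norm y)\<^sup>2"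
    and "(norm (X y - adj Y y))\<^sup>2 = (norm (X y))\<^sup>2 + (norm (adj Y y))\<^sup>2 - 2 * (norm y)\<^sup>2"
    by (simp_all add: power2_norm_eq_inner inner_add_left inner_add_right inner_diff_left
        inner_diff_right inner_commute)
qed

section \<open>Norm estimate for the polarized difference\<close>

lemma vec_norm_add: "vec_norm n (\<lambda>i. x i + y i) \<le> vec_norm n x + vec_norm n y"
proof -
  have "vec_norm n (\<lambda>i. x i + y i) \<le> L2_set (\<lambda>i. norm (x i) + norm (y i)) {..<n}"
    unfolding vec_norm_def by (rule L2_set_mono) (auto intro: norm_triangle_ineq)
  also have "\<dots> \<le> vec_norm n x + vec_norm n y"
    unfolding vec_norm_def by (rule L2_set_triangle_ineq)
  finally show ?thesis .
qed

lemma vec_norm_diff: "vec_norm n (\<lambda>i. x i - y i) \<le> vec_norm n x + vec_norm n y"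
  using vec_norm_add[of n x "\<lambda>i. - y i"] by (simp add: vec_norm_def)

lemma vec_norm_blinfun_le:
  assumes "norm T \<le> c"
  shows "vec_norm n (\<lambda>i. blinfun_apply T (x i)) \<le> c * vec_norm n x"
proof -
  have c: "0 \<le> c" using assms norm_ge_zero order_trans by blast
  have "norm (T (x i)) \<le> c * norm (x i)" for i
    using norm_blinfun[of T "x i"] mult_right_mono[OF assms, of "norm (x i)"] by simp
  then have "vec_norm n (\<lambda>i. T (x i)) \<le> L2_set (\<lambda>i. c * norm (x i)) {..<n}"
    unfolding vec_norm_def by (intro L2_set_mono) auto
  then show ?thesis using c by (simp add: vec_norm_def L2_set_right_distrib)
qed

lemma adj_compose:
  assumes "S \<in> bounded_ops" "T \<in> bounded_ops"
  shows "adj (S o\<^sub>L T) = adj T o\<^sub>L adj S"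
  by (rule adj_eqI) (use assms in \<open>simp_all add: bounded_ops_compose inner_adj\<close>)

lemma adj_diff:
  assumes "S \<in> bounded_ops" "T \<in> bounded_ops"
  shows "adj (S - T) = adj S - adj T"
  by (rule adj_eqI) (use assms in \<open>simp_all add: bounded_ops_diff inner_adj blinfun.diff_left
    inner_diff_left inner_diff_right\<close>)

lemma adj_scaleR:
  assumes "T \<in> bounded_ops"
  shows "adj (c *\<^sub>R T) = c *\<^sub>R adj T"
  by (rule adj_eqI) (use assms in \<open>simp_all add: bounded_ops_scaleR inner_adj blinfun.scaleR_left\<close>)

lemma adj_adj:
  assumes "T \<in> bounded_ops"
  shows "adj (adj T) = T"
  by (rule adj_eqI[OF adj_bounded_ops[OF assms]]) (simp add: inner_adj'[OF assms])

lemma clinear_into_ops_conjugate: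
  assumes f: "clinear_into_ops S f" and R: "R \<in> bounded_ops" and T: "T \<in> bounded_ops"
  shows "clinear_into_ops S (\<lambda>a. R o\<^sub>L f a o\<^sub>L T)"
  unfolding clinear_into_ops_def
proof (intro conjI ballI allI)
  show "(\<lambda>a. R o\<^sub>L f a o\<^sub>L T) ` S \<subseteq> bounded_ops"
    using clinear_into_opsD(1)[OF f] R T by (auto intro!: bounded_ops_compose)
  show "R o\<^sub>L f (a + b) o\<^sub>L T = (R o\<^sub>L f a o\<^sub>L T) + (R o\<^sub>L f b o\<^sub>L T)" if "a \<in> S" "b \<in> S" for a b
    by (rule blinfun_eqI) (simp add: clinear_into_opsD(2)[OF f that] blinfun.add_left blinfun.add_right)
  show "R o\<^sub>L f (c *\<^sub>C a) o\<^sub>L T = c *\<^sub>C (R o\<^sub>L f a o\<^sub>L T)" if "a \<in> S" for c a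
    by (rule blinfun_eqI) (simp add: clinear_into_opsD(3)[OF f that] bounded_opsD[OF R])
qed

text \<open>With \<open>C = W - D\<close>, \<open>B = W + D\<close> and \<open>\<psi> = W* \<sigma> W / \<kappa>\<^sup>2\<close> one has
  \<open>C* \<sigma> B - \<psi> = (1 - 1/\<kappa>\<^sup>2) W* \<sigma> W + W* \<sigma> D - D* \<sigma> W - D* \<sigma> D\<close>.\<close>

lemma polarized_mat_norm_le:
  fixes s :: "nat \<Rightarrow> nat \<Rightarrow> 'k::chilbert_space \<Rightarrow>\<^sub>L 'k" and W D :: "'p::chilbert_space \<Rightarrow>\<^sub>L 'k"
  assumes W: "W \<in> bounded_ops" "norm W \<le> \<kappa>" and D: "D \<in> bounded_ops" "norm D \<le> \<delta>"
    and s: "mat_norm n s \<le> 1" and k: "\<kappa> \<ge> 1"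
  shows "mat_norm n (\<lambda>i j. (adj (W - D) o\<^sub>L s i j o\<^sub>L (W + D)) - (1 / \<kappa>\<^sup>2) *\<^sub>R (adj W o\<^sub>L s i j o\<^sub>L W))
    \<le> \<kappa>\<^sup>2 - 1 + 2 * \<kappa> * \<delta> + \<delta>\<^sup>2" (is "mat_norm n ?E \<le> ?c")
proof (rule mat_norm_leI)
  have \<delta>: "0 \<le> \<delta>" using D(2) norm_ge_zero order_trans by blast
  have k2: "1 \<le> \<kappa>\<^sup>2" using k by simp
  then show "0 \<le> ?c" using k \<delta> by simp
  fix x :: "nat \<Rightarrow> 'p"
  let ?N = "vec_norm n x"
  define p where "p = mat_app n s (\<lambda>j. W (x j))"
  define q where "q = mat_app n s (\<lambda>j. D (x j))"
  have contr: "vec_norm n (mat_app n s y) \<le> vec_norm n y" for y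
    using mat_app_le_mat_norm[of n s y] mult_right_mono[OF s vec_norm_nonneg[of n y]] by simp
  have p: "vec_norm n p \<le> \<kappa> * ?N"
    unfolding p_def by (rule order_trans[OF contr vec_norm_blinfun_le[OF W(2)]])
  have q: "vec_norm n q \<le> \<delta> * ?N"
    unfolding q_def by (rule order_trans[OF contr vec_norm_blinfun_le[OF D(2)]])
  have W': "norm (adj W) \<le> \<kappa>" and D': "norm (adj D) \<le> \<delta>"
    using norm_adj_le[OF W(1)] norm_adj_le[OF D(1)] W(2) D(2) by linarith+
  have Wy: "vec_norm n (\<lambda>i. adj W (y i)) \<le> \<kappa> * c" if "vec_norm n y \<le> c" for y c
    by (rule order_trans[OF vec_norm_blinfun_le[OF W'] mult_left_mono[OF that]]) (use k in simp)
  have Dy: "vec_norm n (\<lambda>i. adj D (y i)) \<le> \<delta> * c" if "vec_norm n y \<le> c" for y c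
    by (rule order_trans[OF vec_norm_blinfun_le[OF D'] mult_left_mono[OF that \<delta>]])
  \<comment> \<open>What remains of the W-W term after subtracting \<psi>; being nonnegative, it
    contributes t \<kappa>^2 = \<kappa>^2 - 1.\<close>
  let ?t = "1 - 1 / \<kappa>\<^sup>2"
  have "1 / \<kappa>\<^sup>2 \<le> 1 / 1" by (rule divide_left_mono) (use k2 in auto)
  then have t: "0 \<le> ?t" by simp
  have "mat_app n ?E x i = (?t *\<^sub>R adj W (p i) + adj W (q i)) - (adj D (p i) + adj D (q i))" for i
  proof -
    let ?a = "\<lambda>j. adj W (s i j (W (x j)))" and ?b = "\<lambda>j. adj W (s i j (D (x j)))"
      and ?c = "\<lambda>j. adj D (s i j (W (x j)))" and ?d = "\<lambda>j. adj D (s i j (D (x j)))"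
    have "?E i j (x j) = (?t *\<^sub>R ?a j + ?b j) - (?c j + ?d j)" for j
      unfolding adj_diff[OF W(1) D(1)]
      by (simp add: blinfun.diff_left blinfun.add_left blinfun.add_right blinfun.scaleR_left scaleR_diff_left)
    then have "mat_app n ?E x i = (\<Sum>j<n. (?t *\<^sub>R ?a j + ?b j) - (?c j + ?d j))"
      unfolding mat_app_def by (intro sum.cong refl)
    also have "\<dots> = (?t *\<^sub>R (\<Sum>j<n. ?a j) + (\<Sum>j<n. ?b j)) - ((\<Sum>j<n. ?c j) + (\<Sum>j<n. ?d j))"
      by (simp only: sum_subtractf sum.distrib scaleR_sum_right)
    also have "\<dots> = (?t *\<^sub>R adj W (p i) + adj W (q i)) - (adj D (p i) + adj D (q i))"
      unfolding p_def q_def mat_app_def blinfun.sum_right ..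
    finally show ?thesis .
  qed
  then have "vec_norm n (mat_app n ?E x)
      = vec_norm n (\<lambda>i. (?t *\<^sub>R adj W (p i) + adj W (q i)) - (adj D (p i) + adj D (q i)))"
    by (intro vec_norm_cong)
  also have "\<dots> \<le> (vec_norm n (\<lambda>i. ?t *\<^sub>R adj W (p i)) + vec_norm n (\<lambda>i. adj W (q i)))
      + (vec_norm n (\<lambda>i. adj D (p i)) + vec_norm n (\<lambda>i. adj D (q i)))"
    by (intro order_trans[OF vec_norm_diff] add_mono vec_norm_add)
  also have "\<dots> \<le> (?t * (\<kappa> * (\<kappa> * ?N)) + \<kappa> * (\<delta> * ?N)) + (\<delta> * (\<kappa> * ?N) + \<delta> * (\<delta> * ?N))"
    unfolding vec_norm_scaleR abs_of_nonneg[OF t]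
    by (intro add_mono mult_left_mono Wy Dy p q t)
  also have "?t * (\<kappa> * (\<kappa> * ?N)) = (\<kappa>\<^sup>2 - 1) * ?N"
  proof -
    have "?t * \<kappa>\<^sup>2 = \<kappa>\<^sup>2 - 1" using k by (simp add: left_diff_distrib)
    moreover have "?t * (\<kappa> * (\<kappa> * ?N)) = (?t * \<kappa>\<^sup>2) * ?N"
      by (simp only: power2_eq_square mult.assoc)
    ultimately show ?thesis by simp
  qed
  finally show "vec_norm n (mat_app n ?E x) \<le> ?c * ?N"
    by (simp add: algebra_simps power2_eq_square)
qed

theorem theorem1p2:
  fixes M :: "('h::chilbert_space \<Rightarrow>\<^sub>L 'h) set"
    and \<phi> :: "('h \<Rightarrow>\<^sub>L 'h) \<Rightarrow> ('p::chilbert_space \<Rightarrow>\<^sub>L 'p)"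
    and r :: real
  assumes "operator_space M"
    and "r \<ge> 1"
    and "\<phi> \<in> P_class TYPE('k::chilbert_space) r M"
  shows "(\<exists>(V :: 'p \<Rightarrow>\<^sub>L 'k) (\<sigma> :: ('h \<Rightarrow>\<^sub>L 'h) \<Rightarrow> ('k \<Rightarrow>\<^sub>L 'k)) X Y.
            hilbert_inclusion V \<and>
            star_hom (cstar_generated M) \<sigma> \<and>
            mutually_inverse X Y \<and> norm X = norm Y \<and> norm Y \<le> sqrt r \<and>
            (\<forall>a\<in>M. \<phi> a = compression V (X o\<^sub>L \<sigma> a o\<^sub>L Y)))
       \<and> (\<exists>\<psi> :: ('h \<Rightarrow>\<^sub>L 'h) \<Rightarrow> ('p \<Rightarrow>\<^sub>L 'p).
            clinear_into_ops (cstar_generated M) \<psi> \<and>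
            contractive (cstar_generated M) \<psi> \<and>
            completely_positive (cstar_generated M) \<psi> \<and>
            cb_norm M (\<lambda>a. \<phi> a - \<psi> a) \<le> ereal (r - 1))"
proof -

  \<comment> \<open>The similarity produces a *-homomorphism\<close>
  define A where "A = cstar_generated M"
  have A: "cstar_subalgebra A"
    using assms(1) cstar_subalgebra_cstar_generated by (auto simp: operator_space_def A_def)
  have MA: "M \<subseteq> A" unfolding A_def cstar_generated_def by (rule hull_subset)
  from assms(3) obtain V :: "'p \<Rightarrow>\<^sub>L 'k" and \<theta> :: "('h \<Rightarrow>\<^sub>L 'h) \<Rightarrow> ('k \<Rightarrow>\<^sub>L 'k)" where
    V: "hilbert_inclusion V" and \<theta>: "op_hom A \<theta>" and sim: "paulsen_similarity A \<theta> (sqrt r)"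
    and \<phi>: "\<And>a. a \<in> M \<Longrightarrow> \<phi> a = compression V (\<theta> a)"
    unfolding P_class_def A_def by blast
  from sim obtain X Y where XY: "mutually_inverse X Y" and nXY: "norm X = norm Y" "norm Y \<le> sqrt r"
    and cc: "completely_contractive A (\<lambda>a. X o\<^sub>L \<theta> a o\<^sub>L Y)"
    unfolding paulsen_similarity_def by blast
  have Xo: "X \<in> bounded_ops" and Yo: "Y \<in> bounded_ops"
    using XY by (auto simp: mutually_inverse_def)
  note inv = mutually_inverse_apply[OF XY]
  have Vo: "V \<in> bounded_ops" and nV: "\<And>x. norm (V x) = norm x"
    using V by (auto simp: hilbert_inclusion_def)
  define \<sigma> where "\<sigma> a = X o\<^sub>L \<theta> a o\<^sub>L Y" for a
  have \<theta>\<sigma>: "\<theta> a = Y o\<^sub>L \<sigma> a o\<^sub>L X" for a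
    by (rule blinfun_eqI) (simp add: \<sigma>_def inv)
  have cc: "completely_contractive A \<sigma>" using cc by (simp add: \<sigma>_def[abs_def])
  have lin: "clinear_into_ops A \<sigma>"
    unfolding \<sigma>_def[abs_def] by (rule clinear_into_ops_conjugate[OF op_homD(1)[OF \<theta>] Xo Yo])
  have "\<sigma> (a o\<^sub>L b) = \<sigma> a o\<^sub>L \<sigma> b" if "a \<in> A" "b \<in> A" for a b
    by (rule blinfun_eqI) (simp add: \<sigma>_def op_homD(2)[OF \<theta> that] inv)
  with lin have hom: "op_hom A \<sigma>" by (simp add: op_hom_def)
  have contr: "contractive A \<sigma>"
    by (rule completely_contractive_imp_contractive[OF cc lin subspace_cstar_subalgebra[OF A]])
  have star: "star_hom A \<sigma>" by (rule contractive_hom_imp_star_hom[OF A hom contr])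

  \<comment> \<open>The roles are exchanged: \<open>\<sigma>\<close> is \<open>\<theta>\<close>
    conjugated by \<open>X\<close>, so \<open>\<theta>\<close> is recovered with \<open>Y\<close> on
    the left, and \<open>Y\<close> serves as the operator X of the claim.\<close>
  have part1: "hilbert_inclusion V \<and> star_hom A \<sigma> \<and> mutually_inverse Y X \<and> norm Y = norm X \<and>
      norm X \<le> sqrt r \<and> (\<forall>a\<in>M. \<phi> a = compression V (Y o\<^sub>L \<sigma> a o\<^sub>L X))"
    using V star XY nXY \<phi> by (simp add: mutually_inverse_def \<theta>\<sigma>[symmetric])

  \<comment> \<open>The completely positive approximation\<close>
  define \<kappa> where "\<kappa> = (sqrt r + 1 / sqrt r) / 2"
  define \<delta> where "\<delta> = (sqrt r - 1 / sqrt r) / 2"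
  have r1: "sqrt r \<ge> 1" using assms(2) by simp
  have sr: "sqrt r * sqrt r = r" using assms(2) by simp
  have \<kappa>2: "\<kappa>\<^sup>2 = (r + 1 / r + 2) / 4" and \<delta>2: "\<delta>\<^sup>2 = (r + 1 / r - 2) / 4"
    unfolding \<kappa>_def \<delta>_def using assms(2)
    by (simp_all add: power_divide power2_sum power2_diff)
  have \<delta>: "\<delta> \<ge> 0"
  proof -
    have "1 / sqrt r \<le> 1" using r1 by simp
    then show ?thesis using r1 by (simp add: \<delta>_def del: real_sqrt_ge_1_iff)
  qed
  have "\<kappa>\<^sup>2 = \<delta>\<^sup>2 + 1"
    unfolding \<kappa>2 \<delta>2 by (simp add: add_divide_distrib diff_divide_distrib)
  then have "1 \<le> \<kappa>\<^sup>2" using zero_le_power2[of \<delta>] by linarith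
  moreover have "0 \<le> \<kappa>" using assms(2) by (simp add: \<kappa>_def)
  ultimately have \<kappa>: "\<kappa> \<ge> 1" using power2_le_imp_le[of 1 \<kappa>] by simp
  \<comment> \<open>In hyperbolic terms, \<kappa>^2 - 1 = \<delta>^2 and \<kappa> + \<delta> = sqrt
    r, so the sum is 2 \<delta> (\<kappa> + \<delta>) = r - 1.\<close>
  have err: "\<kappa>\<^sup>2 - 1 + 2 * \<kappa> * \<delta> + \<delta>\<^sup>2 = r - 1"
  proof -
    have "2 * ((s + t) / 2) * ((s - t) / 2) = (s * s - t * t) / 2" for s t :: real
      by (simp add: field_simps)
    then have "2 * \<kappa> * \<delta> = (sqrt r * sqrt r - (1 / sqrt r) * (1 / sqrt r)) / 2"
      unfolding \<kappa>_def \<delta>_def .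
    also have "\<dots> = (r - 1 / r) / 2" using assms(2) by simp
    finally have "2 * \<kappa> * \<delta> = (r - 1 / r) / 2" .
    moreover have "(r + k + 2) / 4 - 1 + (r - k) / 2 + (r + k - 2) / 4 = r - 1" for k
      by (simp add: field_simps)
    ultimately show ?thesis by (simp only: \<kappa>2 \<delta>2)
  qed
  define W where "W = (1 / 2) *\<^sub>R ((X + adj Y) o\<^sub>L V)"
  define D where "D = (1 / 2) *\<^sub>R ((X - adj Y) o\<^sub>L V)"
  have Wo: "W \<in> bounded_ops" and Do: "D \<in> bounded_ops"
    unfolding W_def D_def
    by (intro bounded_ops_scaleR bounded_ops_compose bounded_ops_add bounded_ops_diff Xo adj_bounded_ops Yo Vo)+
  have nX: "norm X \<le> sqrt r" using nXY by simp
  note base = similarity_norm_sq_le[OF XY assms(2) nX nXY(2)]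
  have nW: "norm W \<le> \<kappa>"
  proof (rule norm_blinfun_bound)
    fix x
    show "norm (W x) \<le> \<kappa> * norm x"
    proof (rule power2_le_imp_le)
      have "(norm (W x))\<^sup>2 = (norm (X (V x) + adj Y (V x)))\<^sup>2 / 4"
        by (simp add: W_def blinfun.scaleR_left blinfun.add_left power_divide)
      also have "\<dots> \<le> ((r + 1 / r) * (norm x)\<^sup>2 + 2 * (norm x)\<^sup>2) / 4"
        using base[of "V x"] unfolding similarity_combination_norm_sq(1)[OF XY] nV
        by (intro divide_right_mono add_right_mono) simp_all
      also have "\<dots> = (\<kappa> * norm x)\<^sup>2"
        unfolding power_mult_distrib \<kappa>2 by (simp add: distrib_right)
      finally show "(norm (W x))\<^sup>2 \<le> (\<kappa> * norm x)\<^sup>2" .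
    qed (use \<kappa> in simp)
  qed (use \<kappa> in simp)
  have nD: "norm D \<le> \<delta>"
  proof (rule norm_blinfun_bound)
    fix x
    show "norm (D x) \<le> \<delta> * norm x"
    proof (rule power2_le_imp_le)
      have "(norm (D x))\<^sup>2 = (norm (X (V x) - adj Y (V x)))\<^sup>2 / 4"
        by (simp add: D_def blinfun.scaleR_left blinfun.diff_left power_divide)
      also have "\<dots> \<le> ((r + 1 / r) * (norm x)\<^sup>2 - 2 * (norm x)\<^sup>2) / 4"
        using base[of "V x"] unfolding similarity_combination_norm_sq(2)[OF XY] nV
        by (intro divide_right_mono diff_right_mono) simp_all
      also have "\<dots> = (\<delta> * norm x)\<^sup>2"
        unfolding power_mult_distrib \<delta>2 by (simp add: left_diff_distrib)
      finally show "(norm (D x))\<^sup>2 \<le> (\<delta> * norm x)\<^sup>2" .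
    qed (use \<delta> in simp)
  qed (use \<delta> in simp)
  have sum: "W + D = X o\<^sub>L V"
    by (rule blinfun_eqI)
      (simp add: W_def D_def blinfun.add_left blinfun.diff_left blinfun.scaleR_left scaleR_add_right[symmetric]
        scaleR_2[symmetric] del: scaleR_add_right)
  have "W - D = adj Y o\<^sub>L V"
    by (rule blinfun_eqI)
      (simp add: W_def D_def blinfun.add_left blinfun.diff_left blinfun.scaleR_left scaleR_diff_right[symmetric]
        scaleR_2[symmetric] del: scaleR_diff_right)
  then have diff: "adj (W - D) = adj V o\<^sub>L Y"
    by (simp add: adj_compose[OF adj_bounded_ops[OF Yo] Vo] adj_adj[OF Yo])
  have \<phi>_eq: "\<phi> a = adj (W - D) o\<^sub>L \<sigma> a o\<^sub>L (W + D)" if "a \<in> M" for a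
    unfolding \<phi>[OF that] \<theta>\<sigma> compression_def sum diff by (rule blinfun_eqI) simp

  \<comment> \<open>Splitting 1/\<kappa>^2 over both sides makes \<open>\<psi>\<close> a conjugation
    of \<open>\<sigma>\<close> by a contraction, from which contractivity and complete positivity
    follow.\<close>
  define W' where "W' = (1 / \<kappa>) *\<^sub>R W"
  define \<psi> where "\<psi> a = adj W' o\<^sub>L \<sigma> a o\<^sub>L W'" for a
  have W'o: "W' \<in> bounded_ops" unfolding W'_def by (rule bounded_ops_scaleR[OF Wo])
  have nW': "norm W' \<le> 1" using nW \<kappa> by (simp add: W'_def divide_le_eq)
  have nW'a: "norm (adj W') \<le> 1" using norm_adj_le[OF W'o] nW' by linarith
  have \<psi>_eq: "\<psi> a = (1 / \<kappa>\<^sup>2) *\<^sub>R (adj W o\<^sub>L \<sigma> a o\<^sub>L W)" for a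
    by (rule blinfun_eqI)
      (simp add: \<psi>_def W'_def adj_scaleR[OF Wo] blinfun.scaleR_left blinfun.scaleR_right power2_eq_square)
  have \<psi>_lin: "clinear_into_ops A \<psi>"
    unfolding \<psi>_def[abs_def] by (rule clinear_into_ops_conjugate[OF lin adj_bounded_ops[OF W'o] W'o])
  have \<psi>_contr: "contractive A \<psi>"
    unfolding contractive_def
  proof
    fix a assume a: "a \<in> A"
    have "norm (\<psi> a) \<le> norm (adj W' o\<^sub>L \<sigma> a) * norm W'"
      unfolding \<psi>_def by (rule norm_blinfun_compose)
    also have "\<dots> \<le> norm (adj W' o\<^sub>L \<sigma> a)"
      by (rule mult_left_le[OF nW' norm_ge_zero])
    also have "\<dots> \<le> norm (adj W') * norm (\<sigma> a)" by (rule norm_blinfun_compose)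
    also have "\<dots> \<le> norm (\<sigma> a)" by (rule mult_left_le_one_le) (simp_all add: nW'a)
    also have "\<dots> \<le> norm a" using contr a by (simp add: contractive_def)
    finally show "norm (\<psi> a) \<le> norm a" .
  qed
  have \<psi>_pos: "completely_positive A \<psi>"
    unfolding \<psi>_def[abs_def]
    by (rule completely_positive_conjugate[OF star_hom_completely_positive[OF A star cc] W'o])
  have "cb_norm M (\<lambda>a. \<phi> a - \<psi> a) \<le> ereal (r - 1)"
    unfolding cb_norm_def
  proof (rule SUP_least, clarsimp)
    fix n and B :: "nat \<Rightarrow> nat \<Rightarrow> 'h \<Rightarrow>\<^sub>L 'h"
    assume B: "\<forall>i<n. \<forall>j<n. B i j \<in> M" and nB: "mat_norm n B \<le> 1"
    let ?E = "\<lambda>i j. (adj (W - D) o\<^sub>L \<sigma> (B i j) o\<^sub>L (W + D)) - (1 / \<kappa>\<^sup>2) *\<^sub>R (adj W o\<^sub>L \<sigma> (B i j) o\<^sub>L W)"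
    have "mat_norm n (\<lambda>i j. \<sigma> (B i j)) \<le> 1"
      by (rule completely_contractiveD[OF cc _ nB]) (use B MA in blast)
    then have E: "mat_norm n ?E \<le> r - 1"
      using polarized_mat_norm_le[OF Wo nW Do nD _ \<kappa>] by (simp add: err)
    \<comment> \<open>The two matrices are known to agree only at indices below n, where the entries
      of \<open>B\<close> lie in \<open>M\<close>; the norms are therefore compared through
      \<open>mat_app\<close>.\<close>
    show "mat_norm n (\<lambda>i j. \<phi> (B i j) - \<psi> (B i j)) \<le> r - 1"
    proof (rule mat_norm_leI)
      show "0 \<le> r - 1" using assms(2) by simp
      fix x
      have "vec_norm n (mat_app n (\<lambda>i j. \<phi> (B i j) - \<psi> (B i j)) x) = vec_norm n (mat_app n ?E x)"
        by (intro vec_norm_cong mat_app_cong) (use B in \<open>simp add: \<phi>_eq \<psi>_eq\<close>)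
      also have "\<dots> \<le> mat_norm n ?E * vec_norm n x" by (rule mat_app_le_mat_norm)
      also have "\<dots> \<le> (r - 1) * vec_norm n x" by (rule mult_right_mono[OF E]) simp
      finally show "vec_norm n (mat_app n (\<lambda>i j. \<phi> (B i j) - \<psi> (B i j)) x) \<le> (r - 1) * vec_norm n x" .
    qed
  qed
  with part1 \<psi>_lin \<psi>_contr \<psi>_pos show ?thesis
    unfolding A_def by blast
qed

end
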